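(* Let $\mathcal{H}$ be a complex Hilbert space and $G$ a selfadjoint unitary on $\mathcal{H}$ with $\dim\ker(G+1)=\infty$. Consider the graded $C^*$-algebra $({\rm CAR}(\mathcal{H}),\gamma_G)$ and the unique tracial state $\mu_0$ of ${\rm CAR}(\mathcal{H})$. Then the only $\gamma_G$-twisted tracial functional $\tau$ on ${\rm CAR}(\mathcal{H})$ which is dominated by $\mu_0$ is $\tau=0$. Hence the trace $\mu_0$ has a unique extension to a tracial state on the crossed product ${\rm CAR}(\mathcal{H})\rtimes_{\gamma_G}\mathbb{Z}_2$, namely the canonical one, $\boldsymbol{\tau}^{\rm can}(a,b)=\mu_0(a)$.
   Context: Inner products are linear in the second argument. ${\rm CAR}(\mathcal{H})$ is the unique $C^*$-algebra generated by a unit and elements $a(\varphi)$, $\varphi\in\mathcal{H}$, with $\varphi\mapsto a^*(\varphi)=a(\varphi)^*$ linear, $\{a^*(\varphi),a(\psi)\}=\langle\psi,\varphi\rangle1$, $\{a(\varphi),a(\psi)\}=0$. The grading is the automorphism with $\gamma_G(a(\varphi))=a(G\varphi)$. The $C^*$-algebra ${\rm CAR}(\mathcal{H})$ has a unique tracial state $\mu_0$; with $\Phi(\xi)=a^*(\xi)+a(\xi)$ it is the quasifree state with $\mu_0(\Phi(\xi)\Phi(\eta))=\Re\langle\xi,\eta\rangle$. A $\gamma_G$-twisted tracial functional is a linear functional $\tau$ with $\tau(xy)=\tau(y\gamma_G(x))$ for all $x,y\in{\rm CAR}(\mathcal{H})$. It is dominated by $\mu_0$ if $|\tau(x^*y)|^2\le\mu_0(x^*x)\mu_0(y^*y)$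 for all $x,y$. For a unital $C^*$-algebra $\mathcal{A}$ with involutive automorphism $\gamma$, the crossed product $\mathcal{A}\rtimes_\gamma\mathbb{Z}_2$ is $\mathcal{A}\oplus\mathcal{A}$ with product $(a,b)(a',b')=(aa'+b\gamma(b'),\,ab'+b\gamma(a'))$, involution $(a,b)^*=(a^*,\gamma(b^* ))$, unit $(1,0)$, and norm $\|(a,b)\|$ equal to the norm of $\begin{pmatrix}a&b\\ \gamma(b)&\gamma(a)\end{pmatrix}\in M_2(\mathcal{A})$; $\mathcal{A}$ is identified with $\mathcal{A}\oplus0$. *)

theory Defs
  imports "HOL-Analysis.Analysis"
begin

subsection \<open>Complex vector spaces and complex Hilbert spaces\<close>

class scaleC =
  fixes scaleC :: "complex \<Rightarrow> 'a \<Rightarrow> 'a" (infixr "*\<^sub>C" 75)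

text \<open>The real structure inherited from \<^class>\<open>real_vector\<close> is the restriction of scalars, so that
  the library's norms, topology and completeness apply.\<close>

class complex_vector = real_vector + scaleC +
  assumes scaleC_add_right: "c *\<^sub>C (x + y) = c *\<^sub>C x + c *\<^sub>C y"
    and scaleC_add_left: "(c + d) *\<^sub>C x = c *\<^sub>C x + d *\<^sub>C x"
    and scaleC_scaleC: "c *\<^sub>C d *\<^sub>C x = (c * d) *\<^sub>C x"
    and scaleC_one: "1 *\<^sub>C x = x"
    and scaleR_scaleC: "r *\<^sub>R x = complex_of_real r *\<^sub>C x"

global_interpretation complex_vector: vector_space "scaleC :: complex \<Rightarrow> 'a \<Rightarrow> 'a::complex_vector"
  defines cspan = "complex_vector.span"
  by unfold_locales (simp_all add: scaleC_add_right scaleC_add_left scaleC_scaleC scaleC_one)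

instantiation complex :: complex_vector
begin
definition scaleC_complex_def: "c *\<^sub>C (z::complex) = c * z"
instance
  by standard (simp_all add: scaleC_complex_def algebra_simps scaleR_conv_of_real)
end

instantiation prod :: (complex_vector, complex_vector) complex_vector
begin
definition scaleC_prod_def: "c *\<^sub>C p = (c *\<^sub>C fst p, c *\<^sub>C snd p)"
instance
  by standard
    (simp_all add: scaleC_prod_def prod_eq_iff scaleC_add_right scaleC_add_left scaleC_scaleC
      scaleC_one scaleR_scaleC)
end

abbreviation clinear :: "('a::complex_vector \<Rightarrow> 'b::complex_vector) \<Rightarrow> bool"
  where "clinear f \<equiv> Vector_Spaces.linear scaleC scaleC f"

definition infinite_cdim :: "'a::complex_vector set \<Rightarrow> bool"
  where "infinite_cdim V \<longleftrightarrow> \<not> (\<exists>B. finite B \<and> V \<subseteq> cspan B)"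

text \<open>The inner product is linear in the second argument.  The norm comes from
  \<^class>\<open>real_inner\<close>, whose real inner product is the real part of the complex one.\<close>

class complex_hilbert = real_inner + complete_space + complex_vector +
  fixes cinner :: "'a \<Rightarrow> 'a \<Rightarrow> complex"
  assumes cinner_add_right: "cinner x (y + z) = cinner x y + cinner x z"
    and cinner_scaleC_right: "cinner x (c *\<^sub>C y) = c * cinner x y"
    and cinner_commute: "cinner x y = cnj (cinner y x)"
    and inner_eq_Re_cinner: "inner x y = Re (cinner x y)"

definition unitary :: "('h::complex_hilbert \<Rightarrow> 'h) \<Rightarrow> bool"
  where "unitary U \<longleftrightarrow> clinear U \<and> surj U \<and> (\<forall>x y. cinner (U x) (U y) = cinner x y)"

definition selfadjoint :: "('h::complex_hilbert \<Rightarrow> 'h) \<Rightarrow> bool"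
  where "selfadjoint A \<longleftrightarrow> clinear A \<and> (\<forall>x y. cinner (A x) y = cinner x (A y))"


subsection \<open>Unital C*-algebras\<close>

text \<open>As \<^class>\<open>real_normed_algebra_1\<close> contains \<open>norm 1 = 1\<close>, the zero algebra is excluded.\<close>

class cstar_algebra = real_normed_algebra_1 + banach + complex_vector +
  fixes star :: "'a \<Rightarrow> 'a"
  assumes mult_scaleC_left: "(c *\<^sub>C x) * y = c *\<^sub>C (x * y)"
    and mult_scaleC_right: "x * (c *\<^sub>C y) = c *\<^sub>C (x * y)"
    and norm_scaleC: "norm (c *\<^sub>C x) = cmod c * norm x"
    and star_add: "star (x + y) = star x + star y"
    and star_scaleC: "star (c *\<^sub>C x) = cnj c *\<^sub>C star x"
    and star_mult: "star (x * y) = star y * star x"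
    and star_star: "star (star x) = x"
    and cstar_identity: "norm (star x * x) = (norm x)\<^sup>2"

definition unital_star_subalgebra :: "'a::cstar_algebra set \<Rightarrow> bool"
  where "unital_star_subalgebra S \<longleftrightarrow>
    1 \<in> S \<and> (\<forall>x\<in>S. \<forall>y\<in>S. x + y \<in> S \<and> x * y \<in> S) \<and> (\<forall>c. \<forall>x\<in>S. c *\<^sub>C x \<in> S) \<and> (\<forall>x\<in>S. star x \<in> S)"

definition star_automorphism :: "('a::cstar_algebra \<Rightarrow> 'a) \<Rightarrow> bool"
  where "star_automorphism \<gamma> \<longleftrightarrow>
    clinear \<gamma> \<and> bij \<gamma> \<and> (\<forall>x y. \<gamma> (x * y) = \<gamma> x * \<gamma> y) \<and> (\<forall>x. \<gamma> (star x) = star (\<gamma> x))"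

text \<open>The multiplication of a crossed product depends on the automorphism, so a crossed product
  cannot be an instance of \<^class>\<open>cstar_algebra\<close>.  The following record holds the operations
  of a C*-algebra over a given complex vector space explicitly, so that the notion of tracial state
  applies both to a type of class \<^class>\<open>cstar_algebra\<close> and to its crossed products.\<close>

record 'a cstar_data =
  alg_mult :: "'a \<Rightarrow> 'a \<Rightarrow> 'a"
  alg_one :: 'a
  alg_star :: "'a \<Rightarrow> 'a"
  alg_norm :: "'a \<Rightarrow> real"

definition class_cstar :: "'a::cstar_algebra cstar_data"
  where "class_cstar = \<lparr>alg_mult = (*), alg_one = 1, alg_star = star, alg_norm = norm\<rparr>"

definition tracial_state :: "'a::complex_vector cstar_data \<Rightarrow> ('a \<Rightarrow> complex) \<Rightarrow> bool"
  where "tracial_state A \<mu> \<longleftrightarrow>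
    clinear \<mu> \<and>
    (\<forall>x. \<mu> (alg_mult A (alg_star A x) x) \<in> \<real>\<^sub>\<ge>\<^sub>0) \<and>
    \<mu> (alg_one A) = 1 \<and>
    (\<forall>x y. \<mu> (alg_mult A x y) = \<mu> (alg_mult A y x))"


subsection \<open>Crossed products by involutive automorphisms\<close>

text \<open>The C*-norm on the two-by-two matrices over \<open>'a\<close>, with rows \<open>(a, b)\<close> and \<open>(c, d)\<close>, is the
  operator norm for the action by left multiplication on the Hilbert module of columns, whose
  norm is given by \<open>\<parallel>(x, y)\<parallel>\<^sup>2 = \<parallel>x\<^sup>*x + y\<^sup>*y\<parallel>\<close>.\<close>

definition column_norm :: "'a::cstar_algebra \<Rightarrow> 'a \<Rightarrow> real"
  where "column_norm x y = sqrt (norm (star x * x + star y * y))"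

definition matrix2_norm :: "'a::cstar_algebra \<Rightarrow> 'a \<Rightarrow> 'a \<Rightarrow> 'a \<Rightarrow> real"
  where "matrix2_norm a b c d =
    Sup {column_norm (a * x + b * y) (c * x + d * y) | x y. column_norm x y \<le> 1}"

definition crossed_product_Z2 :: "('a::cstar_algebra \<Rightarrow> 'a) \<Rightarrow> ('a \<times> 'a) cstar_data"
  where "crossed_product_Z2 \<gamma> =
    \<lparr>alg_mult = (\<lambda>(a, b) (a', b'). (a * a' + b * \<gamma> b', a * b' + b * \<gamma> a')),
     alg_one = (1, 0),
     alg_star = (\<lambda>(a, b). (star a, \<gamma> (star b))),
     alg_norm = (\<lambda>(a, b). matrix2_norm a b (\<gamma> b) (\<gamma> a))\<rparr>"


subsection \<open>The CAR algebra and twisted tracial functionals\<close>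

text \<open>\<open>CAR_algebra a\<close> says that the C*-algebra \<open>'a\<close>, together with \<open>a\<close>, is a copy of the CAR algebra
  over \<open>'h\<close>: the last condition says that \<open>'a\<close> is its only closed unital *-subalgebra containing
  all \<open>a \<phi>\<close>.  Such a pair is unique up to isomorphism.\<close>

definition CAR_algebra :: "('h::complex_hilbert \<Rightarrow> 'a::cstar_algebra) \<Rightarrow> bool"
  where "CAR_algebra a \<longleftrightarrow>
    clinear (\<lambda>\<phi>. star (a \<phi>)) \<and>
    (\<forall>\<phi> \<psi>. star (a \<phi>) * a \<psi> + a \<psi> * star (a \<phi>) = cinner \<psi> \<phi> *\<^sub>C 1) \<and>
    (\<forall>\<phi> \<psi>. a \<phi> * a \<psi> + a \<psi> * a \<phi> = 0) \<and>
    (\<lambda>S. closed S \<and> unital_star_subalgebra S) hull (range a) = UNIV"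

definition twisted_tracial :: "('a::cstar_algebra \<Rightarrow> 'a) \<Rightarrow> ('a \<Rightarrow> complex) \<Rightarrow> bool"
  where "twisted_tracial \<gamma> \<tau> \<longleftrightarrow> clinear \<tau> \<and> (\<forall>x y. \<tau> (x * y) = \<tau> (y * \<gamma> x))"

text \<open>\<open>dominated \<mu> \<tau>\<close> is used for states \<open>\<mu>\<close> only; then \<open>\<mu> (star x * x)\<close> is real.\<close>

definition dominated :: "('a::cstar_algebra \<Rightarrow> complex) \<Rightarrow> ('a \<Rightarrow> complex) \<Rightarrow> bool"
  where "dominated \<mu> \<tau> \<longleftrightarrow>
    (\<forall>x y. (cmod (\<tau> (star x * y)))\<^sup>2 \<le> Re (\<mu> (star x * x)) * Re (\<mu> (star y * y)))"

end

theory Submission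
  imports Defs
begin

text \<open>
  Monomials (words) in the \<open>a(\<phi>)\<close> and \<open>a\<^sup>*(\<phi>)\<close> span a dense *-subalgebra, and a functional dominated
  by the trace is norm continuous, because the trace is a positive functional and these are bounded.
  So a dominated twisted trace \<open>\<tau>\<close> is zero as soon as it is zero on every word \<open>w\<close>.  Let \<open>u\<close> be a
  unitary with \<open>u\<^sup>2 = 1\<close>; twisting gives \<open>\<tau>(w) = \<tau>(u (u w)) = \<tau>(u w \<gamma>(u))\<close>, and two choices of \<open>u\<close>
  turn this into \<open>\<tau>(w) = - \<tau>(w)\<close>.

  \<^item> If \<open>w\<close> has even length, take \<open>u = a(e) + a\<^sup>*(e)\<close> for a unit vector \<open>e\<close> of \<open>ker (G + 1)\<close>
    orthogonal to all vectors that occur in \<open>w\<close>; here \<open>dim ker (G + 1) = \<infinity>\<close> enters.  This \<open>u\<close>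
    anticommutes with every letter, so \<open>u w = w u\<close>, whereas \<open>\<gamma>(u) = - u\<close>
    (\<open>field_unitary\<close>).

  \<^item> If \<open>w\<close> has odd length, take \<open>u\<close> to be the parity operator \<open>\<Prod> (1 - 2 a\<^sup>*(b) a(b))\<close> over an
    orthonormal basis of the span of the \<open>G\<close>-fixed components of the vectors in \<open>w\<close>.  It negates
    these components and leaves the \<open>G\<close>-negated ones alone, so it acts on each letter as \<open>-\<gamma>\<close>, and
    \<open>u w u = - \<gamma>(w)\<close>.  As \<open>\<gamma>(u) = u\<close> and \<open>\<tau>(\<gamma>(w)) = \<tau>(w)\<close>, the claim follows
    (\<open>parity_unitary_for_letters\<close>).

  For the crossed product, an extension \<open>T\<close> of the trace is determined by \<open>y \<mapsto> T(0, y)\<close>.  The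
  trace property of \<open>T\<close> makes this a twisted trace, and the Cauchy--Schwarz inequality for \<open>T\<close>
  makes it dominated, so it is zero.  Conversely, the canonical extension is a trace because
  \<open>\<mu>\<^sub>0\<close> is \<open>\<gamma>\<close>-invariant: \<open>\<mu>\<^sub>0 \<circ> \<gamma>\<close> is again a tracial state, and two tracial states agree on all
  words (\<open>trace_zero_on_words\<close>, applied to their difference).  The density arguments apply to
  functionals such as \<open>\<mu>\<^sub>0 \<circ> \<gamma>\<close> rather than to \<open>\<gamma>\<close> itself: they are bounded because they are
  positive.
\<close>

section \<open>Complex-linear maps and positive sesquilinear forms\<close>

lemma clinear_iff:
  "clinear f \<longleftrightarrow> (\<forall>x y. f (x + y) = f x + f y) \<and> (\<forall>c x. f (c *\<^sub>C x) = c *\<^sub>C f x)"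
  by (simp add: Vector_Spaces.linear_iff complex_vector.vector_space_axioms)

lemma clinear_add: "clinear f \<Longrightarrow> f (x + y) = f x + f y"
  and clinear_scaleC: "clinear f \<Longrightarrow> f (c *\<^sub>C x) = c *\<^sub>C f x"
  by (auto simp: clinear_iff)

lemma scaleC_zero_left [simp]: "0 *\<^sub>C (x::'a::complex_vector) = 0"
  and scaleC_minus_one: "(-1) *\<^sub>C (x::'a::complex_vector) = - x"
  and scaleC_zero_right [simp]: "c *\<^sub>C (0::'a::complex_vector) = 0"
  by (auto simp: complex_vector.scale_minus_left scaleC_one)

lemma clinear_zero: "clinear f \<Longrightarrow> f 0 = 0"
  using clinear_scaleC[of f 0 0] by simp

lemma clinear_minus: "clinear f \<Longrightarrow> f (- x) = - f x"
  using clinear_scaleC[of f "-1" x] by (simp add: scaleC_minus_one)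

lemma clinear_diff: "clinear f \<Longrightarrow> f (x - y) = f x - f y"
  using clinear_add[of f x "- y"] by (simp add: clinear_minus)

lemma clinear_scaleR: "clinear f \<Longrightarrow> f (r *\<^sub>R x) = r *\<^sub>R f x"
  by (simp add: scaleR_scaleC clinear_scaleC)

lemma complex_nonneg_iff: "z \<in> \<real>\<^sub>\<ge>\<^sub>0 \<longleftrightarrow> 0 \<le> Re z \<and> Im z = 0"
  by (auto simp: complex_nonneg_Reals_iff)

text \<open>This form of the inequality also covers the crossed product, whose operations belong to no
  type class.  Hermitian symmetry of \<open>q\<close> is a consequence of positivity, by polarization; the rest is
  the discriminant of \<open>t \<mapsto> q(x + c y, x + c y)\<close> for \<open>c = t \<cdot> cnj (q x y)\<close>.\<close>

lemma positive_form_Cauchy_Schwarz: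
  fixes q :: "'a::complex_vector \<Rightarrow> 'a \<Rightarrow> complex"
  assumes add_r: "\<And>x y z. q x (y + z) = q x y + q x z"
    and add_l: "\<And>x y z. q (x + y) z = q x z + q y z"
    and sc_r: "\<And>c x y. q x (c *\<^sub>C y) = c * q x y"
    and sc_l: "\<And>c x y. q (c *\<^sub>C x) y = cnj c * q x y"
    and pos: "\<And>x. q x x \<in> \<real>\<^sub>\<ge>\<^sub>0"
  shows "(cmod (q x y))\<^sup>2 \<le> Re (q x x) * Re (q y y)"
proof -
  define A B C where "A = Re (q x x)" and "B = (cmod (q x y))\<^sup>2" and "C = Re (q y y)"
  have nn: "A \<ge> 0" "B \<ge> 0" "C \<ge> 0"
    using pos by (auto simp: A_def B_def C_def complex_nonneg_iff)
  have 1: "q (x + z) (x + z) = q x x + q x z + q z x + q z z" for z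
    by (simp add: add_r add_l)
  have im0: "Im (q w w) = 0" for w using pos by (auto simp: complex_nonneg_iff)
  have im: "Im (q x z + q z x) = 0" for z
    using 1[of z] im0[of "x+z"] im0[of x] im0[of z] by simp
  have "Im (q x y) = - Im (q y x)" using im[of y] by simp
  moreover have "Re (q x y) = Re (q y x)" using im[of "\<i> *\<^sub>C y"] by (simp add: sc_r sc_l)
  ultimately have herm: "q y x = cnj (q x y)" by (simp add: complex_eq_iff)
  \<comment> \<open>the phase in \<open>c\<close> makes the cross terms real, so that a real quadratic in \<open>t\<close> remains\<close>
  have quad: "0 \<le> A + 2 * t * B + t\<^sup>2 * B * C" for t :: real
  proof -
    define c where "c = complex_of_real t * cnj (q x y)"
    have a: "c * q x y = complex_of_real (t * B)"
      unfolding c_def B_def of_real_mult complex_norm_square by (simp add: mult_ac)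
    have b: "cnj c * q y x = complex_of_real (t * B)"
      using arg_cong[OF a, of cnj] by (simp add: herm)
    have d: "cnj c * c = complex_of_real (t\<^sup>2 * B)"
      unfolding c_def B_def of_real_mult complex_norm_square
      by (simp add: power2_eq_square mult_ac)
    have "q (x + c *\<^sub>C y) (x + c *\<^sub>C y) = q x x + c * q x y + cnj c * q y x + cnj c * c * q y y"
      by (simp add: add_r add_l sc_r sc_l algebra_simps)
    hence "Re (q (x + c *\<^sub>C y) (x + c *\<^sub>C y)) = A + 2 * t * B + t\<^sup>2 * B * C"
      unfolding a b d by (simp add: A_def C_def)
    thus ?thesis using pos[of "x + c *\<^sub>C y"] by (auto simp: complex_nonneg_iff)
  qed
  have "B \<le> A * C"
  proof (cases "C = 0")
    case True
    have "B = 0"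
    proof (rule ccontr)
      assume "B \<noteq> 0"
      \<comment> \<open>the affine function \<open>A + 2tB\<close> takes the value \<open>-1\<close> at this \<open>t\<close>\<close>
      thus False using quad[of "- (A + 1) / (2 * B)"] nn True by (simp add: field_simps)
    qed
    thus ?thesis using nn by simp
  next
    case False
    hence "C > 0" using nn by simp
    have "0 \<le> A + 2 * (- 1 / C) * B + (- 1 / C)\<^sup>2 * B * C" by (rule quad)
    also have "\<dots> = (A * C - B) / C" using \<open>C > 0\<close> by (simp add: field_simps power2_eq_square)
    finally show ?thesis using \<open>C > 0\<close> by (simp add: zero_le_divide_iff)
  qed
  thus ?thesis by (simp add: A_def B_def C_def)
qed

section \<open>Positive functionals on a unital C*-algebra\<close>

lemma star_one [simp]: "star (1::'a::cstar_algebra) = 1"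
  by (metis mult.left_neutral star_mult star_star)

lemma star_zero [simp]: "star (0::'a::cstar_algebra) = 0"
  by (metis add_cancel_right_left star_add)

lemma star_minus: "star (- x) = - star (x::'a::cstar_algebra)"
  by (metis add.right_inverse add_eq_0_iff star_add star_zero)

lemma star_diff: "star (x - y) = star x - star (y::'a::cstar_algebra)"
  using star_add[of x "- y"] by (simp add: star_minus)

lemma star_scaleR: "star (r *\<^sub>R x) = r *\<^sub>R star (x::'a::cstar_algebra)"
  by (simp add: scaleR_scaleC star_scaleC)

lemma norm_star [simp]: "norm (star x) = norm (x::'a::cstar_algebra)"
proof -
  have le: "norm y \<le> norm (star y)" for y :: 'a
  proof (cases "norm y = 0")
    case False
    have "norm y * norm y \<le> norm (star y) * norm y"
      using norm_mult_ineq[of "star y" y] by (simp add: cstar_identity power2_eq_square)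
    thus ?thesis using False by simp
  qed simp
  show ?thesis using le[of x] le[of "star x"] by (simp add: star_star)
qed

lemma bounded_linear_star: "bounded_linear (star :: 'a::cstar_algebra \<Rightarrow> 'a)"
  by (rule bounded_linear_intro[where K=1]) (auto simp: star_add star_scaleR)

lemma bounded_linear_scaleC: "bounded_linear (\<lambda>x::'a::cstar_algebra. c *\<^sub>C x)"
  by (rule bounded_linear_intro[where K="cmod c"])
    (auto simp: scaleC_add_right norm_scaleC scaleR_scaleC scaleC_scaleC mult.commute)

lemma star_power: "star (x ^ n) = star (x::'a::cstar_algebra) ^ n"
  by (induction n) (auto simp: star_mult power_commutes)

text \<open>The square root of \<open>1 - h\<close> is given by the binomial series \<open>\<Sum> (1/2 choose n) (-h)\<^sup>n\<close>, which
  converges absolutely for \<open>\<parallel>h\<parallel> < 1\<close>.  Vandermonde's identity evaluates its Cauchy square as the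
  series for the exponent \<open>1\<close>, which is \<open>1 - h\<close>.\<close>

lemma one_minus_small_selfadjoint_is_square:
  fixes h :: "'a::cstar_algebra"
  assumes sa: "star h = h" and small: "norm h < 1"
  obtains y where "star y * y = 1 - h"
proof -
  define f where "f n = ((1/2::real) gchoose n) *\<^sub>R (- h) ^ n" for n
  have "summable (\<lambda>n. norm (((1/2::real) gchoose n) * norm h ^ n))"
    using small by (intro abs_summable_in_conv_radius)
      (auto simp: conv_radius_gchoose one_ereal_def)
  moreover have "norm (norm (f n)) \<le> norm (((1/2::real) gchoose n) * norm h ^ n)" for n
    using norm_power_ineq[of "- h" n] by (simp add: f_def abs_mult mult_left_mono)
  ultimately have sum_n: "summable (\<lambda>n. norm (f n))"
    by (rule summable_comparison_test'[where N=0])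
  hence sum: "summable f" by (rule summable_norm_cancel)
  define y where "y = suminf f"
  have "star y = (\<Sum>n. star (f n))"
    unfolding y_def using bounded_linear.suminf[OF bounded_linear_star sum] .
  also have "(\<lambda>n. star (f n)) = f"
    by (auto simp: f_def star_scaleR star_power star_minus sa)
  finally have "star y = y" by (simp add: y_def)
  have coeff: "(\<Sum>i\<le>k. f i * f (k - i)) = ((1::real) gchoose k) *\<^sub>R (- h) ^ k" for k
  proof -
    have "(\<Sum>i\<le>k. f i * f (k - i))
      = (\<Sum>i\<le>k. (((1/2::real) gchoose i) * ((1/2) gchoose (k - i))) *\<^sub>R (- h) ^ k)"
      by (intro sum.cong) (auto simp: f_def power_add[symmetric])
    also have "\<dots> = (\<Sum>i\<le>k. ((1/2::real) gchoose i) * ((1/2) gchoose (k - i))) *\<^sub>R (- h) ^ k"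
      by (simp add: scaleR_sum_left)
    also have "(\<Sum>i\<le>k. ((1/2::real) gchoose i) * ((1/2) gchoose (k - i))) = 1 gchoose k"
      using gbinomial_Vandermonde[of "1/2::real" "1/2" k] by (simp add: atMost_atLeast0)
    finally show ?thesis .
  qed
  have "(\<lambda>k. \<Sum>i\<le>k. f i * f (k - i)) sums (y * y)"
    unfolding y_def by (rule Cauchy_product_sums[OF sum_n sum_n])
  moreover have "(\<lambda>k. ((1::real) gchoose k) *\<^sub>R (- h) ^ k) sums
      (\<Sum>k\<in>{0,1}. ((1::real) gchoose k) *\<^sub>R (- h) ^ k)"
  proof (rule sums_finite)
    fix k :: nat assume "k \<notin> {0, 1}"
    hence "(1::nat) < k" by auto
    hence "(1::real) gchoose k = 0"
      using binomial_gbinomial[of 1 k, where 'a=real] by (simp add: binomial_eq_0)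
    thus "((1::real) gchoose k) *\<^sub>R (- h) ^ k = 0" by simp
  qed auto
  ultimately have "y * y = 1 - h"
    unfolding coeff using sums_unique2 by fastforce
  thus ?thesis using that \<open>star y = y\<close> by metis
qed

definition positive_functional :: "('a::cstar_algebra \<Rightarrow> complex) \<Rightarrow> bool"
  where "positive_functional f \<longleftrightarrow> clinear f \<and> (\<forall>x. f (star x * x) \<in> \<real>\<^sub>\<ge>\<^sub>0)"

text \<open>Automatic continuity of positive functionals: for \<open>s > \<parallel>x\<parallel>\<^sup>2\<close> the element \<open>1 - x\<^sup>*x / s\<close> is of
  the form \<open>y\<^sup>*y\<close>, so \<open>f\<close> is nonnegative on it.\<close>

lemma positive_functional_bound:
  assumes "positive_functional f"
  shows "Re (f (star x * x)) \<le> Re (f 1) * (norm x)\<^sup>2"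
proof -
  have lin: "clinear f" and pos: "\<And>x. 0 \<le> Re (f (star x * x))"
    using assms by (auto simp: positive_functional_def complex_nonneg_iff)
  have less: "Re (f (star x * x)) \<le> Re (f 1) * s" if s: "s > (norm x)\<^sup>2" for s
  proof -
    have s0: "s > 0" using s by (meson le_less_trans zero_le_power2)
    define h where "h = (1 / s) *\<^sub>R (star x * x)"
    have "star h = h" by (simp add: h_def star_scaleR star_mult star_star)
    moreover have "norm h < 1" using s s0 by (simp add: h_def cstar_identity)
    ultimately obtain y where y: "star y * y = 1 - h"
      by (rule one_minus_small_selfadjoint_is_square)
    have "0 \<le> Re (f (1 - h))" using pos[of y] y by simp
    also have "f (1 - h) = f 1 - (1 / s) *\<^sub>R f (star x * x)"
      using lin by (simp add: h_def clinear_diff clinear_scaleR)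
    finally show ?thesis using s0 by (simp add: field_simps)
  qed
  have "((\<lambda>s. Re (f 1) * s) \<longlongrightarrow> Re (f 1) * (norm x)\<^sup>2) (at_right ((norm x)\<^sup>2))"
    by (intro tendsto_intros)
  moreover have "eventually (\<lambda>s. Re (f (star x * x)) \<le> Re (f 1) * s) (at_right ((norm x)\<^sup>2))"
    using less by (auto simp: eventually_at_right_field intro!: exI[of _ "(norm x)\<^sup>2 + 1"])
  ultimately show ?thesis by (rule tendsto_lowerbound) simp
qed

lemma positive_functional_Cauchy_Schwarz:
  assumes "positive_functional f"
  shows "(cmod (f (star x * y)))\<^sup>2 \<le> Re (f (star x * x)) * Re (f (star y * y))"
proof -
  have lin: "clinear f" and pos: "\<And>x. f (star x * x) \<in> \<real>\<^sub>\<ge>\<^sub>0"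
    using assms by (auto simp: positive_functional_def)
  show ?thesis
    by (rule positive_form_Cauchy_Schwarz[of "\<lambda>x y. f (star x * y)"])
      (auto simp: star_add algebra_simps clinear_add[OF lin] clinear_scaleC[OF lin] pos
        star_scaleC mult_scaleC_left mult_scaleC_right scaleC_complex_def)
qed

definition norm_bounded :: "('a::real_normed_vector \<Rightarrow> complex) \<Rightarrow> bool"
  where "norm_bounded f \<longleftrightarrow> (\<exists>K. \<forall>x. cmod (f x) \<le> K * norm x)"

lemma norm_bounded_if_square_bounded:
  assumes "\<And>x. (cmod (f x))\<^sup>2 \<le> K * (norm x)\<^sup>2"
  shows "norm_bounded f"
proof -
  have "cmod (f x) \<le> sqrt \<bar>K\<bar> * norm x" for x
  proof (rule power2_le_imp_le)
    have "(cmod (f x))\<^sup>2 \<le> \<bar>K\<bar> * (norm x)\<^sup>2"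
      by (rule order.trans[OF assms]) (simp add: mult_right_mono)
    thus "(cmod (f x))\<^sup>2 \<le> (sqrt \<bar>K\<bar> * norm x)\<^sup>2" by (simp add: power_mult_distrib)
  qed simp
  thus ?thesis unfolding norm_bounded_def by blast
qed

lemma norm_bounded_diff:
  assumes "norm_bounded f" "norm_bounded g"
  shows "norm_bounded (\<lambda>x. f x - g x)"
proof -
  obtain K L where "\<And>x. cmod (f x) \<le> K * norm x" "\<And>x. cmod (g x) \<le> L * norm x"
    using assms unfolding norm_bounded_def by blast
  hence "cmod (f x - g x) \<le> (K + L) * norm x" for x
    by (smt (verit) norm_triangle_ineq4 distrib_right)
  thus ?thesis unfolding norm_bounded_def by blast
qed

text \<open>The factor \<open>b\<close> serves the functionals \<open>y \<mapsto> \<mu>(b y)\<close> and \<open>y \<mapsto> \<mu>(\<gamma>(b y))\<close>, which occur in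
  the trace property of the canonical extension.\<close>

lemma norm_bounded_if_dominated:
  assumes "positive_functional \<mu>" "dominated \<mu> \<tau>"
  shows "norm_bounded (\<lambda>x. \<tau> (b * x))"
proof (rule norm_bounded_if_square_bounded)
  fix x
  have "(cmod (\<tau> (b * x)))\<^sup>2 \<le> Re (\<mu> (b * star b)) * Re (\<mu> (star x * x))"
    using assms(2) unfolding dominated_def by (metis star_star)
  also have "\<dots> \<le> Re (\<mu> (b * star b)) * (Re (\<mu> 1) * (norm x)\<^sup>2)"
    using assms(1) positive_functional_bound[OF assms(1), of x]
    by (intro mult_left_mono) (auto simp: positive_functional_def complex_nonneg_iff
      dest: spec[of _ "star b"] simp: star_star)
  finally show "(cmod (\<tau> (b * x)))\<^sup>2 \<le> Re (\<mu> (b * star b)) * Re (\<mu> 1) * (norm x)\<^sup>2"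
    by (simp add: mult.assoc)
qed

lemma dominated_by_itself: "positive_functional \<mu> \<Longrightarrow> dominated \<mu> \<mu>"
  unfolding dominated_def using positive_functional_Cauchy_Schwarz by blast

lemma norm_bounded_if_positive: "positive_functional \<mu> \<Longrightarrow> norm_bounded \<mu>"
  using norm_bounded_if_dominated[OF _ dominated_by_itself, of \<mu> 1] by simp

section \<open>Orthonormal systems\<close>

lemma cinner_add_left: "cinner (x + y) z = cinner x z + cinner y (z::'h::complex_hilbert)"
  by (metis cinner_add_right cinner_commute complex_cnj_add)

lemma cinner_scaleC_left: "cinner (c *\<^sub>C x) (z::'h::complex_hilbert) = cnj c * cinner x z"
  by (metis cinner_scaleC_right cinner_commute complex_cnj_mult)

lemma cinner_zero_right [simp]: "cinner x (0::'h::complex_hilbert) = 0"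
  using cinner_scaleC_right[of x 0 0] by simp

lemma cinner_zero_left [simp]: "cinner (0::'h::complex_hilbert) x = 0"
  using cinner_scaleC_left[of 0 0 x] by simp

lemma cinner_minus_left: "cinner (- x) (z::'h::complex_hilbert) = - cinner x z"
  using cinner_scaleC_left[of "-1" x z] by (simp add: scaleC_minus_one)

lemma cinner_minus_right: "cinner z (- x::'h::complex_hilbert) = - cinner z x"
  using cinner_scaleC_right[of z "-1" x] by (simp add: scaleC_minus_one)

lemma cinner_diff_right: "cinner z (x - y::'h::complex_hilbert) = cinner z x - cinner z y"
  using cinner_add_right[of z x "- y"] by (simp add: cinner_minus_right)

lemma cinner_sum_right: "cinner z (\<Sum>i\<in>I. f i) = (\<Sum>i\<in>I. cinner z (f i :: 'h::complex_hilbert))"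
  by (induction I rule: infinite_finite_induct) (auto simp: cinner_add_right)

lemma cinner_self: "cinner x (x::'h::complex_hilbert) = complex_of_real ((norm x)\<^sup>2)"
proof -
  have "Im (cinner x x) = 0"
    using cinner_commute[of x x] by (metis Reals_cnj_iff complex_is_Real_iff)
  thus ?thesis by (simp add: complex_eq_iff dot_square_norm[symmetric] inner_eq_Re_cinner)
qed

lemma cinner_orthogonal_sym: "cinner x y = 0 \<longleftrightarrow> cinner y (x::'h::complex_hilbert) = 0"
  using cinner_commute[of x y] by auto

lemma orthogonal_to_span:
  fixes x :: "'h::complex_hilbert"
  assumes "y \<in> cspan B" "\<And>b. b \<in> B \<Longrightarrow> cinner b x = 0"
  shows "cinner y x = 0"
proof -
  have "cspan B \<subseteq> {y. cinner y x = 0}"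
    using assms(2) by (intro complex_vector.span_minimal)
      (auto simp: complex_vector.subspace_def cinner_add_left cinner_scaleC_left)
  thus ?thesis using assms(1) by auto
qed

definition corthonormal :: "'h::complex_hilbert set \<Rightarrow> bool"
  where "corthonormal B \<longleftrightarrow> (\<forall>x\<in>B. \<forall>y\<in>B. cinner x y = (if x = y then 1 else 0))"

text \<open>One step of Gram--Schmidt orthogonalization inside a subspace \<open>V\<close>.\<close>

lemma extend_corthonormal:
  fixes x :: "'h::complex_hilbert"
  assumes "finite B" "corthonormal B" "B \<subseteq> V" "complex_vector.subspace V" "x \<in> V" "x \<notin> cspan B"
  obtains e where "e \<in> V" "cinner e e = 1" "\<And>b. b \<in> B \<Longrightarrow> cinner b e = 0" "x \<in> cspan (insert e B)"
proof -
  define p where "p = (\<Sum>b\<in>B. cinner b x *\<^sub>C b)"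
  have p: "p \<in> cspan B" unfolding p_def
    by (intro complex_vector.span_sum complex_vector.span_scale complex_vector.span_base)
  have pV: "p \<in> V" unfolding p_def using assms
    by (intro complex_vector.subspace_sum complex_vector.subspace_scale) auto
  have orth: "cinner b (x - p) = 0" if "b \<in> B" for b
  proof -
    have "cinner b p = (\<Sum>c\<in>B. if c = b then cinner b x else 0)" unfolding p_def cinner_sum_right
      using assms(2) that by (intro sum.cong) (auto simp: corthonormal_def cinner_scaleC_right)
    thus ?thesis using that assms(1) by (simp add: cinner_diff_right)
  qed
  have nz: "x - p \<noteq> 0" using p assms(6) by auto
  define r where "r = complex_of_real (norm (x - p))"
  have r: "r \<noteq> 0" "cnj r = r" using nz by (auto simp: r_def)
  define e where "e = (1 / r) *\<^sub>C (x - p)"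
  have "x = r *\<^sub>C e + p" using r by (simp add: e_def scaleC_scaleC scaleC_one)
  moreover have "p \<in> cspan (insert e B)"
    using p complex_vector.span_mono[of B "insert e B"] by auto
  ultimately have "x \<in> cspan (insert e B)"
    by (metis complex_vector.span_add complex_vector.span_scale complex_vector.span_base insertI1)
  moreover have "e \<in> V" unfolding e_def using assms pV
    by (intro complex_vector.subspace_scale complex_vector.subspace_diff) auto
  moreover have "cinner e e = 1" using r cinner_self[of "x - p"]
    by (simp add: e_def cinner_scaleC_left cinner_scaleC_right r_def power2_eq_square)
  moreover have "\<And>b. b \<in> B \<Longrightarrow> cinner b e = 0" by (simp add: e_def cinner_scaleC_right orth)
  ultimately show ?thesis using that by blast
qed

lemma finite_subset_in_span_of_corthonormal:
  fixes F :: "'h::complex_hilbert set"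
  assumes "finite F" "F \<subseteq> V" "complex_vector.subspace V"
  obtains B where "finite B" "corthonormal B" "B \<subseteq> V" "F \<subseteq> cspan B"
proof -
  have "\<exists>B. finite B \<and> corthonormal B \<and> B \<subseteq> V \<and> F \<subseteq> cspan B"
    using assms(1,2)
  proof (induction F rule: finite_induct)
    case empty thus ?case by (intro exI[of _ "{}"]) (auto simp: corthonormal_def)
  next
    case (insert x F)
    then obtain B where B: "finite B" "corthonormal B" "B \<subseteq> V" "F \<subseteq> cspan B" by auto
    show ?case
    proof (cases "x \<in> cspan B")
      case True thus ?thesis using B by blast
    next
      case False
      then obtain e where e: "e \<in> V" "cinner e e = 1" "\<And>b. b \<in> B \<Longrightarrow> cinner b e = 0"
        "x \<in> cspan (insert e B)"
        using extend_corthonormal[of B V x] B assms(3) insert.prems by auto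
      have "corthonormal (insert e B)"
        using B(2) e by (auto simp: corthonormal_def cinner_orthogonal_sym[of e])
      moreover have "F \<subseteq> cspan (insert e B)"
        using B(4) complex_vector.span_mono[of B "insert e B"] by auto
      ultimately show ?thesis using B e by (intro exI[of _ "insert e B"]) auto
    qed
  qed
  thus ?thesis using that by blast
qed


text \<open>The vector \<open>G\<^sup>2 x - x\<close> is orthogonal to everything, as \<open>\<langle>G\<^sup>2 x, y\<rangle> = \<langle>G x, G y\<rangle> = \<langle>x, y\<rangle>\<close>.\<close>

lemma unitary_selfadjoint_involution:
  assumes "unitary G" "selfadjoint G"
  shows "G (G x) = (x::'h::complex_hilbert)"
proof -
  define d where "d = G (G x) - x"
  have "cinner d y = 0" for y
  proof -
    have "cinner (G (G x)) y = cinner x y"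
      using assms by (simp add: unitary_def selfadjoint_def)
    thus ?thesis unfolding d_def using cinner_add_left[of "G (G x)" "- x" y]
      by (simp add: cinner_minus_left)
  qed
  hence "d = 0" using cinner_self[of d] by fastforce
  thus ?thesis by (simp add: d_def)
qed

definition fixed_part :: "('h::complex_hilbert \<Rightarrow> 'h) \<Rightarrow> 'h \<Rightarrow> 'h"
  where "fixed_part G \<phi> = (1/2) *\<^sub>C (\<phi> + G \<phi>)"

definition negated_part :: "('h::complex_hilbert \<Rightarrow> 'h) \<Rightarrow> 'h \<Rightarrow> 'h"
  where "negated_part G \<phi> = (1/2) *\<^sub>C (\<phi> - G \<phi>)"

lemma eigenparts:
  fixes G :: "'h::complex_hilbert \<Rightarrow> 'h"
  assumes "unitary G" "selfadjoint G"
  shows "G (fixed_part G \<phi>) = fixed_part G \<phi>"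
    and "G (negated_part G \<phi>) = - negated_part G \<phi>"
    and "\<phi> = negated_part G \<phi> + fixed_part G \<phi>"
proof -
  have lin: "clinear G" using assms by (simp add: unitary_def)
  have G2: "G (G x) = x" for x using unitary_selfadjoint_involution assms by blast
  show "G (fixed_part G \<phi>) = fixed_part G \<phi>"
    using lin by (simp add: fixed_part_def clinear_scaleC clinear_add G2 add.commute)
  show "G (negated_part G \<phi>) = - negated_part G \<phi>"
    using lin by (simp add: negated_part_def clinear_scaleC clinear_diff G2
      complex_vector.scale_minus_right[symmetric])
  have "negated_part G \<phi> + fixed_part G \<phi> = (1/2) *\<^sub>C (2 *\<^sub>R \<phi>)"
    by (simp add: negated_part_def fixed_part_def scaleC_add_right[symmetric] scaleR_2)
  thus "\<phi> = negated_part G \<phi> + fixed_part G \<phi>" by (simp add: scaleR_scaleC scaleC_scaleC scaleC_one)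
qed

lemma eigenspaces_orthogonal:
  assumes "unitary G" "G x = - x" "G y = y"
  shows "cinner x (y::'h::complex_hilbert) = 0"
proof -
  have "cinner x y = cinner (G x) (G y)" using assms(1) by (simp add: unitary_def)
  also have "\<dots> = - cinner x y" by (simp add: assms cinner_minus_left)
  finally show ?thesis by simp
qed

text \<open>It is enough to avoid the components of \<open>F\<close> in the eigenspace itself, since the other
  eigenspace is orthogonal to it.  These components lie in the span of a finite orthonormal \<open>B\<close>,
  which cannot exhaust the eigenspace.\<close>

lemma unit_vector_in_infinite_eigenspace:
  fixes G :: "'h::complex_hilbert \<Rightarrow> 'h"
  assumes G: "unitary G" "selfadjoint G" and "infinite_cdim {x. G x + x = 0}" "finite F"
  obtains e where "G e = - e" "cinner e e = 1" "\<And>\<phi>. \<phi> \<in> F \<Longrightarrow> cinner e \<phi> = 0"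
proof -
  let ?V = "{x. G x + x = 0}"
  have lin: "clinear G" using G by (simp add: unitary_def)
  have sub: "complex_vector.subspace ?V"
    using lin by (auto simp: complex_vector.subspace_def clinear_zero clinear_add clinear_scaleC
      scaleC_add_right[symmetric] algebra_simps)
  obtain B where B: "finite B" "corthonormal B" "B \<subseteq> ?V" "negated_part G ` F \<subseteq> cspan B"
    by (rule finite_subset_in_span_of_corthonormal[of "negated_part G ` F" ?V])
      (use assms(4) sub eigenparts(2)[OF G] in auto)
  obtain x where "x \<in> ?V" "x \<notin> cspan B"
    using assms(3) B(1) unfolding infinite_cdim_def by blast
  then obtain e where e: "e \<in> ?V" "cinner e e = 1" "\<And>b. b \<in> B \<Longrightarrow> cinner b e = 0"
    using extend_corthonormal[OF B(1,2,3) sub, of x] by blast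
  have Ge: "G e = - e" using e(1) by (simp add: eq_neg_iff_add_eq_0)
  have "cinner e \<phi> = 0" if "\<phi> \<in> F" for \<phi>
  proof -
    have "cinner (negated_part G \<phi>) e = 0"
      by (rule orthogonal_to_span[of _ B]) (use B(4) that e(3) in blast)+
    hence "cinner e (negated_part G \<phi>) = 0" using cinner_orthogonal_sym by blast
    moreover have "cinner e (fixed_part G \<phi>) = 0"
      using eigenspaces_orthogonal[OF G(1) Ge] eigenparts(1)[OF G] by blast
    ultimately have "cinner e (negated_part G \<phi> + fixed_part G \<phi>) = 0"
      by (simp add: cinner_add_right)
    thus ?thesis using eigenparts(3)[OF G] by metis
  qed
  thus ?thesis using that Ge e(2) by blast
qed

section \<open>Words in the generators of the CAR algebra\<close>

text \<open>Letters with arguments in \<open>F\<close>; the parameter keeps track of which vectors a given word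
  involves.\<close>

definition letters :: "('h::complex_hilbert \<Rightarrow> 'a::cstar_algebra) \<Rightarrow> 'h set \<Rightarrow> 'a set"
  where "letters a F = a ` F \<union> (\<lambda>\<phi>. star (a \<phi>)) ` F"

definition words :: "('h::complex_hilbert \<Rightarrow> 'a::cstar_algebra) \<Rightarrow> 'a set"
  where "words a = {prod_list xs |xs. set xs \<subseteq> letters a UNIV}"

lemma finite_support_of_word:
  assumes "set xs \<subseteq> letters a UNIV"
  obtains F where "finite F" "set xs \<subseteq> letters a F"
proof -
  have "\<exists>F. finite F \<and> set xs \<subseteq> letters a F"
    using assms
  proof (induction xs)
    case Nil thus ?case by (intro exI[of _ "{}"]) auto
  next
    case (Cons l xs)
    then obtain F where F: "finite F" "set xs \<subseteq> letters a F" by auto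
    obtain \<phi> where "l = a \<phi> \<or> l = star (a \<phi>)" using Cons.prems by (auto simp: letters_def)
    thus ?case using F by (intro exI[of _ "insert \<phi> F"]) (auto simp: letters_def)
  qed
  thus ?thesis using that by blast
qed

lemma letters_star_closed: "l \<in> letters a F \<Longrightarrow> star l \<in> letters a F"
  by (auto simp: letters_def star_star)

lemma word_star: "w \<in> words a \<Longrightarrow> star w \<in> words a"
proof -
  assume "w \<in> words a"
  then obtain xs where xs: "w = prod_list xs" "set xs \<subseteq> letters a UNIV" by (auto simp: words_def)
  have "star (prod_list xs) = prod_list (rev (map star xs))"
    by (induction xs) (auto simp: star_mult)
  moreover have "set (rev (map star xs)) \<subseteq> letters a UNIV"
    using xs(2) letters_star_closed by auto
  ultimately show ?thesis unfolding words_def using xs(1) by blast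
qed

lemma word_mult: "v \<in> words a \<Longrightarrow> w \<in> words a \<Longrightarrow> v * w \<in> words a"
proof -
  assume "v \<in> words a" "w \<in> words a"
  then obtain xs ys where "v = prod_list xs" "set xs \<subseteq> letters a UNIV"
    "w = prod_list ys" "set ys \<subseteq> letters a UNIV" by (auto simp: words_def)
  thus ?thesis unfolding words_def by (intro CollectI exI[of _ "xs @ ys"]) auto
qed

lemma cspan_words_mult:
  assumes x: "x \<in> cspan (words a)" and y: "y \<in> cspan (words a)"
  shows "x * y \<in> cspan (words a)"
proof -
  have "cspan (words a) \<subseteq> {y. v * y \<in> cspan (words a)}" if "v \<in> words a" for v
    using that word_mult[OF that] by (intro complex_vector.span_minimal)
      (auto simp: complex_vector.subspace_def distrib_left mult_scaleC_right
        intro: complex_vector.span_base complex_vector.span_add complex_vector.span_scale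
          complex_vector.span_zero)
  hence "cspan (words a) \<subseteq> {x. x * y \<in> cspan (words a)}"
    using y by (intro complex_vector.span_minimal)
      (auto simp: complex_vector.subspace_def distrib_right mult_scaleC_left
        intro: complex_vector.span_add complex_vector.span_scale complex_vector.span_zero)
  thus ?thesis using x by auto
qed

lemma cspan_words_star: "x \<in> cspan (words a) \<Longrightarrow> star x \<in> cspan (words a)"
proof -
  have "cspan (words a) \<subseteq> {x. star x \<in> cspan (words a)}"
    using word_star by (intro complex_vector.span_minimal)
      (auto simp: complex_vector.subspace_def star_add star_scaleC
        intro: complex_vector.span_base complex_vector.span_add complex_vector.span_scale
          complex_vector.span_zero)
  thus "x \<in> cspan (words a) \<Longrightarrow> star x \<in> cspan (words a)" by auto
qed

text \<open>The words span a unital *-subalgebra containing all \<open>a(\<phi>)\<close>; its closure is a closed one,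
  as the operations are continuous.\<close>

lemma cspan_words_dense:
  assumes "CAR_algebra a"
  shows "closure (cspan (words a)) = UNIV"
proof -
  let ?S = "closure (cspan (words a))"
  have one: "1 \<in> words a" unfolding words_def by (intro CollectI exI[of _ "[]"]) auto
  have cl: "f x \<in> ?S" if "x \<in> ?S" "bounded_linear f" "\<And>y. y \<in> cspan (words a) \<Longrightarrow> f y \<in> ?S" for f x
  proof -
    have "?S \<subseteq> f -` ?S"
      using that(2,3) by (intro closure_minimal continuous_closed_vimage)
        (auto intro: linear_continuous_at)
    thus ?thesis using that(1) by auto
  qed
  have add: "x + y \<in> ?S" if "x \<in> ?S" "y \<in> ?S" for x y
  proof -
    obtain u v where "\<And>n. u n \<in> cspan (words a)" "u \<longlonglongrightarrow> x" "\<And>n. v n \<in> cspan (words a)" "v \<longlonglongrightarrow> y"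
      using \<open>x \<in> ?S\<close> \<open>y \<in> ?S\<close> unfolding closure_sequential by blast
    thus ?thesis unfolding closure_sequential
      by (intro exI[of _ "\<lambda>n. u n + v n"]) (auto intro: complex_vector.span_add tendsto_add)
  qed
  have mult: "x * y \<in> ?S" if "x \<in> ?S" "y \<in> ?S" for x y
  proof -
    obtain u v where "\<And>n. u n \<in> cspan (words a)" "u \<longlonglongrightarrow> x" "\<And>n. v n \<in> cspan (words a)" "v \<longlonglongrightarrow> y"
      using \<open>x \<in> ?S\<close> \<open>y \<in> ?S\<close> unfolding closure_sequential by blast
    thus ?thesis unfolding closure_sequential
      by (intro exI[of _ "\<lambda>n. u n * v n"]) (auto intro: cspan_words_mult tendsto_mult)
  qed
  have "unital_star_subalgebra ?S"
    unfolding unital_star_subalgebra_def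
  proof (intro conjI ballI allI)
    show "1 \<in> ?S" using one closure_subset complex_vector.span_base by blast
    fix x assume x: "x \<in> ?S"
    show "c *\<^sub>C x \<in> ?S" for c
      using x by (rule cl[OF _ bounded_linear_scaleC])
        (meson closure_subset complex_vector.span_scale subsetD)
    show "star x \<in> ?S"
      using x by (rule cl[OF _ bounded_linear_star])
        (meson closure_subset cspan_words_star subsetD)
  qed (use add mult in auto)
  moreover have "range a \<subseteq> ?S"
  proof -
    have "a \<phi> \<in> words a" for \<phi>
      unfolding words_def by (intro CollectI exI[of _ "[a \<phi>]"]) (auto simp: letters_def)
    thus ?thesis using closure_subset complex_vector.span_base by blast
  qed
  ultimately have "(\<lambda>S. closed S \<and> unital_star_subalgebra S) hull (range a) \<subseteq> ?S"
    by (intro hull_minimal) auto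
  thus ?thesis using assms by (auto simp: CAR_algebra_def)
qed

lemma zero_if_zero_on_words:
  assumes "CAR_algebra a" and lin: "clinear f" and bd: "norm_bounded f"
    and words: "\<And>w. w \<in> words a \<Longrightarrow> f w = 0"
  shows "f x = 0"
proof -
  obtain K where K: "\<And>x. cmod (f x) \<le> K * norm x" using bd by (auto simp: norm_bounded_def)
  have "bounded_linear f"
    by (rule bounded_linear_intro[where K=K])
      (auto simp: clinear_add[OF lin] clinear_scaleR[OF lin] K[unfolded mult.commute[of K]])
  hence "closed (f -` {0})"
    by (intro continuous_closed_vimage) (auto intro: linear_continuous_at)
  moreover have "cspan (words a) \<subseteq> f -` {0}"
    using words by (intro complex_vector.span_minimal)
      (auto simp: complex_vector.subspace_def clinear_add[OF lin] clinear_scaleC[OF lin]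
        clinear_zero[OF lin])
  ultimately have "closure (cspan (words a)) \<subseteq> f -` {0}" by (rule closure_minimal[rotated])
  thus ?thesis using cspan_words_dense[OF assms(1)] by auto
qed

text \<open>Passing \<open>c\<close> through each letter costs a sign and an application of the homomorphism \<open>h\<close>.  It
  is applied with \<open>h = id\<close> and with \<open>h = \<gamma>\<close>.\<close>

lemma move_past_word:
  fixes c :: "'a::cstar_algebra"
  assumes "\<And>l. l \<in> set xs \<Longrightarrow> c * l = - (h l * c)"
    and "\<And>x y. h (x * y) = h x * h y" "h 1 = 1"
  shows "c * prod_list xs =
    (if even (length xs) then h (prod_list xs) * c else - (h (prod_list xs) * c))"
  using assms(1)
proof (induction xs)
  case (Cons l xs)
  have "c * (l * prod_list xs) = - (h l * (c * prod_list xs))"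
    using Cons.prems[of l] by (simp add: mult.assoc[symmetric])
  thus ?case using Cons by (simp add: assms(2) mult.assoc)
qed (simp add: assms)

section \<open>Unitaries implementing signs\<close>

lemma CAR_minus: "CAR_algebra a \<Longrightarrow> a (- \<phi>) = - a \<phi>"
  and CAR_add: "CAR_algebra a \<Longrightarrow> a (\<phi> + \<psi>) = a \<phi> + a \<psi>"
proof -
  assume "CAR_algebra a"
  hence lin: "clinear (\<lambda>\<phi>. star (a \<phi>))" by (simp add: CAR_algebra_def)
  show "a (- \<phi>) = - a \<phi>" using clinear_minus[OF lin, of \<phi>] by (metis star_star star_minus)
  show "a (\<phi> + \<psi>) = a \<phi> + a \<psi>" using clinear_add[OF lin, of \<phi> \<psi>] by (metis star_star star_add)
qed

lemma CAR_scaleC: "CAR_algebra a \<Longrightarrow> a (c *\<^sub>C \<phi>) = cnj c *\<^sub>C a \<phi>"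
proof -
  assume "CAR_algebra a"
  hence lin: "clinear (\<lambda>\<phi>. star (a \<phi>))" by (simp add: CAR_algebra_def)
  show ?thesis using clinear_scaleC[OF lin, of c \<phi>] by (metis star_star star_scaleC)
qed

lemma CAR_star_anticommute:
  "CAR_algebra a \<Longrightarrow> star (a \<phi>) * a \<psi> = cinner \<psi> \<phi> *\<^sub>C 1 - a \<psi> * star (a \<phi>)"
  unfolding CAR_algebra_def by (metis add_diff_cancel_right')

lemma CAR_anticommute: "CAR_algebra a \<Longrightarrow> a \<phi> * a \<psi> = - (a \<psi> * a \<phi>)"
  unfolding CAR_algebra_def by (metis add_eq_0_iff2)

lemma CAR_square_zero: "CAR_algebra a \<Longrightarrow> a \<phi> * a \<phi> = 0"
proof -
  assume "CAR_algebra a"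
  hence "2 *\<^sub>R (a \<phi> * a \<phi>) = 0" unfolding CAR_algebra_def scaleR_2 by blast
  thus ?thesis by simp
qed

text \<open>Reduces commutation rules with \<open>a\<^sup>*(\<phi>)\<close> to those with \<open>a(\<phi>)\<close>: take adjoints and multiply by
  \<open>u\<close> on both sides.\<close>

lemma star_intertwine:
  fixes u :: "'a::cstar_algebra"
  assumes "u * u = 1" "star u = u" "u * x = - (y * u)"
  shows "u * star x = - (star y * u)"
proof -
  have "star x * u = - (u * star y)"
    using arg_cong[OF assms(3), of star] by (simp add: star_mult star_minus assms(2))
  hence "u * (star x * u) * u = - (u * u * star y * u)" by (simp add: mult.assoc)
  thus ?thesis using assms(1) by (simp add: mult.assoc)
qed

text \<open>The field operator \<open>a(e) + a\<^sup>*(e)\<close> of a unit vector squares to \<open>\<langle>e, e\<rangle> = 1\<close> and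
  anticommutes with everything orthogonal to \<open>e\<close>; hence it commutes with words of even length in vectors
  orthogonal to \<open>e\<close> and anticommutes with those of odd length.\<close>

lemma field_unitary:
  fixes a :: "'h::complex_hilbert \<Rightarrow> 'a::cstar_algebra"
  assumes car: "CAR_algebra a" and e: "cinner e e = 1" "\<And>\<phi>. \<phi> \<in> F \<Longrightarrow> cinner e \<phi> = 0"
  defines "c \<equiv> a e + star (a e)"
  shows "c * c = 1" "star c = c" "l \<in> letters a F \<Longrightarrow> c * l = - (l * c)"
proof -
  have sq: "star (a e) * star (a e) = 0"
    using CAR_square_zero[OF car, of e] by (metis star_mult star_zero)
  show cc: "c * c = 1"
    by (simp add: c_def distrib_left distrib_right CAR_square_zero[OF car] sq
      CAR_star_anticommute[OF car] e scaleC_one)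
  show sc: "star c = c" by (simp add: c_def star_add star_star add.commute)
  have "c * a \<phi> = - (a \<phi> * c)" if "\<phi> \<in> F" for \<phi>
    using that e(2)[OF that] cinner_orthogonal_sym[of e \<phi>] CAR_anticommute[OF car, of e \<phi>]
    by (simp add: c_def distrib_left distrib_right CAR_star_anticommute[OF car])
  thus "l \<in> letters a F \<Longrightarrow> c * l = - (l * c)"
    using star_intertwine[OF cc sc] by (auto simp: letters_def)
qed

text \<open>Since \<open>n = a\<^sup>*(b) a(b)\<close> is a projection, \<open>1 - 2n\<close> is a symmetry.  It is even in the
  generators at \<open>b\<close>, hence commutes with the generators orthogonal to \<open>b\<close>.\<close>

lemma single_parity_unitary:
  fixes a :: "'h::complex_hilbert \<Rightarrow> 'a::cstar_algebra"
  assumes car: "CAR_algebra a" and b: "cinner b b = 1"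
  defines "v \<equiv> 1 - 2 *\<^sub>R (star (a b) * a b)"
  shows "v * v = 1" "star v = v" "v * a b = - (a b * v)"
    "cinner b k = 0 \<Longrightarrow> v * a k = a k * v"
proof -
  let ?n = "star (a b) * a b"
  have aa: "a b * star (a b) = 1 - ?n"
    using CAR_star_anticommute[OF car, of b b] b by (simp add: scaleC_one)
  have an: "a b * ?n = a b"
    using aa CAR_square_zero[OF car, of b] by (simp add: mult.assoc[symmetric] left_diff_distrib)
      (simp add: mult.assoc)
  have na: "?n * a b = 0" using CAR_square_zero[OF car, of b] by (simp add: mult.assoc)
  have nn: "?n * ?n = ?n" using an by (simp add: mult.assoc)
  have "(1 - (n + n)) * (1 - (n + n)) = 1" if "n * n = n" for n :: 'a
    using that by (simp add: left_diff_distrib right_diff_distrib distrib_left distrib_right)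
  from this[OF nn] show "v * v = 1" by (simp add: v_def scaleR_2)
  show "star v = v" by (simp add: v_def star_diff star_scaleR star_mult star_star)
  have "v * a b = a b" using na by (simp add: v_def left_diff_distrib)
  moreover have "a b * v = - a b" using an by (simp add: v_def right_diff_distrib distrib_left scaleR_2)
  ultimately show "v * a b = - (a b * v)" by simp
  assume "cinner b k = 0"
  hence k: "cinner k b = 0" using cinner_orthogonal_sym by blast
  have "?n * a k = - (star (a b) * a k * a b)"
    using CAR_anticommute[OF car, of b k] by (simp add: mult.assoc)
  also have "\<dots> = a k * ?n" using k by (simp add: CAR_star_anticommute[OF car] mult.assoc)
  finally show "v * a k = a k * v" by (simp add: v_def left_diff_distrib right_diff_distrib)
qed

text \<open>The product of the commuting symmetries \<open>1 - 2 a\<^sup>*(b) a(b)\<close>, \<open>b \<in> B\<close>.  On words it implements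
  the second quantization of the reflection that is \<open>-1\<close> on the span of \<open>B\<close> and \<open>1\<close> on its
  orthogonal complement; \<open>\<gamma>\<close> fixes each factor.\<close>

lemma parity_unitary:
  fixes a :: "'h::complex_hilbert \<Rightarrow> 'a::cstar_algebra"
  assumes car: "CAR_algebra a" and "finite B" "corthonormal B"
    and "star_automorphism \<gamma>" and fixed: "\<And>b. b \<in> B \<Longrightarrow> \<gamma> (a b) = a b"
    and \<gamma>1: "\<gamma> 1 = 1"
  obtains u where "u * u = 1" "star u = u" "\<gamma> u = u"
    "\<And>\<phi>. \<phi> \<in> cspan B \<Longrightarrow> u * a \<phi> = - (a \<phi> * u)"
    "\<And>\<phi>. (\<And>b. b \<in> B \<Longrightarrow> cinner b \<phi> = 0) \<Longrightarrow> u * a \<phi> = a \<phi> * u"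
proof -
  have lin: "clinear \<gamma>" and mult: "\<And>x y. \<gamma> (x * y) = \<gamma> x * \<gamma> y" and st: "\<And>x. \<gamma> (star x) = star (\<gamma> x)"
    using assms(4) by (auto simp: star_automorphism_def)
  have "\<exists>u. u * u = 1 \<and> star u = u \<and> \<gamma> u = u \<and> (\<forall>b\<in>B. u * a b = - (a b * u)) \<and>
    (\<forall>\<phi>. (\<forall>b\<in>B. cinner b \<phi> = 0) \<longrightarrow> u * a \<phi> = a \<phi> * u)"
    using assms(2,3) fixed
  proof (induction B rule: finite_induct)
    case empty show ?case by (intro exI[of _ 1]) (auto simp: \<gamma>1)
  next
    case (insert b B)
    then obtain u where u: "u * u = 1" "star u = u" "\<gamma> u = u" "\<forall>b\<in>B. u * a b = - (a b * u)"
      "\<forall>\<phi>. (\<forall>b\<in>B. cinner b \<phi> = 0) \<longrightarrow> u * a \<phi> = a \<phi> * u"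
      by (auto simp: corthonormal_def)
    have bb: "cinner b b = 1" and orth: "\<And>d. d \<in> B \<Longrightarrow> cinner b d = 0 \<and> cinner d b = 0"
      using insert.prems(1) insert.hyps(2) by (auto simp: corthonormal_def)
    define v where "v = 1 - 2 *\<^sub>R (star (a b) * a b)"
    note v = single_parity_unitary[OF car bb, folded v_def]
    have ub: "u * a b = a b * u" using u(5) orth by blast
    have "star (a b) * u = u * star (a b)"
      using arg_cong[OF ub, of star] by (simp add: star_mult u(2))
    hence uv: "u * v = v * u"
      by (simp add: v_def left_diff_distrib right_diff_distrib)
        (metis ub mult.assoc)
    show ?case
    proof (intro exI[of _ "v * u"] conjI ballI allI impI)
      show "(v * u) * (v * u) = 1" by (metis uv u(1) v(1) mult.assoc mult.right_neutral)
      show "star (v * u) = v * u" by (simp add: star_mult u v uv)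
      show "\<gamma> (v * u) = v * u"
        using insert.prems(2)[of b]
        by (simp add: mult u(3) v_def clinear_diff[OF lin] clinear_scaleR[OF lin] st \<gamma>1)
      fix d assume d: "d \<in> insert b B"
      show "v * u * a d = - (a d * (v * u))"
      proof (cases "d = b")
        case True
        have "v * u * a b = (v * a b) * u" by (simp add: mult.assoc ub)
        thus ?thesis using v(3) True by (simp add: mult.assoc)
      next
        case False
        hence dB: "d \<in> B" using d by simp
        hence "v * u * a d = - ((v * a d) * u)" using u(4) by (simp add: mult.assoc)
        thus ?thesis using v(4)[of d] orth[OF dB] by (simp add: mult.assoc)
      qed
    next
      fix \<phi> assume \<phi>: "\<forall>d\<in>insert b B. cinner d \<phi> = 0"
      hence "v * u * a \<phi> = (v * a \<phi>) * u" using u(5) by (simp add: mult.assoc)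
      thus "v * u * a \<phi> = a \<phi> * (v * u)" using v(4)[of \<phi>] \<phi> by (simp add: mult.assoc)
    qed
  qed
  then obtain u where u: "u * u = 1" "star u = u" "\<gamma> u = u" "\<forall>b\<in>B. u * a b = - (a b * u)"
    "\<forall>\<phi>. (\<forall>b\<in>B. cinner b \<phi> = 0) \<longrightarrow> u * a \<phi> = a \<phi> * u" by blast
  have "cspan B \<subseteq> {\<phi>. u * a \<phi> = - (a \<phi> * u)}"
    using u(4) CAR_scaleC[OF car, of 0 0] by (intro complex_vector.span_minimal)
      (auto simp: complex_vector.subspace_def CAR_add[OF car] CAR_scaleC[OF car] distrib_left
        distrib_right mult_scaleC_left mult_scaleC_right complex_vector.scale_minus_right)
  thus ?thesis using that u by blast
qed


text \<open>Split \<open>\<phi> = m + p\<close> into \<open>G m = - m\<close> and \<open>G p = p\<close>.  Choosing \<open>B\<close> to span all \<open>p\<close>, the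
  parity operator sends \<open>a(\<phi>)\<close> to \<open>a(m - p) = - a(G \<phi>)\<close>.\<close>

lemma parity_unitary_for_letters:
  fixes a :: "'h::complex_hilbert \<Rightarrow> 'a::cstar_algebra"
  assumes G: "unitary G" "selfadjoint G" and car: "CAR_algebra a"
    and aut: "star_automorphism \<gamma>" and \<gamma>a: "\<And>\<phi>. \<gamma> (a \<phi>) = a (G \<phi>)" and \<gamma>1: "\<gamma> 1 = 1"
    and "finite F"
  obtains u where "u * u = 1" "\<gamma> u = u" "\<And>l. l \<in> letters a F \<Longrightarrow> u * l = - (\<gamma> l * u)"
proof -
  have sub: "complex_vector.subspace {x. G x = x}"
    using G(1) by (auto simp: unitary_def complex_vector.subspace_def clinear_zero clinear_add
      clinear_scaleC)
  obtain B where B: "finite B" "corthonormal B" "B \<subseteq> {x. G x = x}" "fixed_part G ` F \<subseteq> cspan B"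
    by (rule finite_subset_in_span_of_corthonormal[of "fixed_part G ` F" "{x. G x = x}"])
      (use assms(7) sub eigenparts(1)[OF G] in auto)
  have "\<gamma> (a b) = a b" if "b \<in> B" for b using that B(3) \<gamma>a by auto
  then obtain u where u: "u * u = 1" "star u = u" "\<gamma> u = u"
    "\<And>\<phi>. \<phi> \<in> cspan B \<Longrightarrow> u * a \<phi> = - (a \<phi> * u)"
    "\<And>\<phi>. (\<And>b. b \<in> B \<Longrightarrow> cinner b \<phi> = 0) \<Longrightarrow> u * a \<phi> = a \<phi> * u"
    using parity_unitary[OF car B(1,2) aut _ \<gamma>1] by blast
  have ua: "u * a \<phi> = - (\<gamma> (a \<phi>) * u)" if "\<phi> \<in> F" for \<phi>
  proof -
    let ?m = "negated_part G \<phi>" and ?p = "fixed_part G \<phi>"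
    have "cinner b ?m = 0" if "b \<in> B" for b
      using eigenspaces_orthogonal[OF G(1) eigenparts(2)[OF G]] that B(3)
        cinner_orthogonal_sym by blast
    hence um: "u * a ?m = a ?m * u" by (rule u(5))
    have up: "u * a ?p = - (a ?p * u)" using u(4) B(4) that by blast
    have "G \<phi> = G (?m + ?p)" using eigenparts(3)[OF G, of \<phi>] by simp
    also have "\<dots> = - ?m + ?p"
      using G(1) clinear_add[of G ?m ?p] by (simp add: unitary_def eigenparts(1,2)[OF G])
    finally have "\<gamma> (a \<phi>) = - a ?m + a ?p" by (simp only: \<gamma>a CAR_add[OF car] CAR_minus[OF car])
    moreover have "a \<phi> = a ?m + a ?p" using eigenparts(3)[OF G, of \<phi>] CAR_add[OF car] by metis
    ultimately show ?thesis by (simp add: distrib_left distrib_right um up left_diff_distrib)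
  qed
  have "u * star (a \<phi>) = - (\<gamma> (star (a \<phi>)) * u)" if "\<phi> \<in> F" for \<phi>
    using star_intertwine[OF u(1,2) ua[OF that]] aut by (simp add: star_automorphism_def)
  hence "u * l = - (\<gamma> l * u)" if "l \<in> letters a F" for l
    using that ua by (auto simp: letters_def)
  thus ?thesis using that u(1,3) by blast
qed

section \<open>Traces and twisted traces on words\<close>

lemma star_automorphism_one:
  assumes "star_automorphism \<gamma>"
  shows "\<gamma> 1 = 1"
proof -
  obtain x where "\<gamma> x = 1" using assms by (metis star_automorphism_def bij_pointE)
  thus ?thesis using assms by (metis star_automorphism_def mult.left_neutral mult.right_neutral)
qed

lemma complex_eq_minus_self: "z = - z \<Longrightarrow> z = (0::complex)"
  by (simp add: complex_eq_iff)

lemma twisted_trace_zero_on_words: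
  fixes a :: "'h::complex_hilbert \<Rightarrow> 'a::cstar_algebra"
  assumes G: "unitary G" "selfadjoint G" "infinite_cdim {x. G x + x = 0}" and car: "CAR_algebra a"
    and aut: "star_automorphism \<gamma>" and \<gamma>a: "\<And>\<phi>. \<gamma> (a \<phi>) = a (G \<phi>)"
    and \<tau>: "twisted_tracial \<gamma> \<tau>" and "w \<in> words a"
  shows "\<tau> w = 0"
proof -
  have lin: "clinear \<tau>" and tw: "\<And>x y. \<tau> (x * y) = \<tau> (y * \<gamma> x)"
    using \<tau> by (auto simp: twisted_tracial_def)
  have \<gamma>1: "\<gamma> 1 = 1" using star_automorphism_one aut .
  have mult: "\<And>x y. \<gamma> (x * y) = \<gamma> x * \<gamma> y" using aut by (simp add: star_automorphism_def)
  obtain xs where xs: "w = prod_list xs" "set xs \<subseteq> letters a UNIV"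
    using \<open>w \<in> words a\<close> by (auto simp: words_def)
  obtain F where F: "finite F" "set xs \<subseteq> letters a F"
    using finite_support_of_word[OF xs(2)] .
  show ?thesis
  proof (cases "even (length xs)")
    case True
    obtain e where e: "G e = - e" "cinner e e = 1" "\<And>\<phi>. \<phi> \<in> F \<Longrightarrow> cinner e \<phi> = 0"
      using unit_vector_in_infinite_eigenspace[OF G F(1)] by blast
    define c where "c = a e + star (a e)"
    note c = field_unitary[OF car e(2,3), of F, folded c_def]
    have "\<gamma> c = - c"
      using aut by (simp add: c_def star_automorphism_def clinear_add \<gamma>a e(1) CAR_minus[OF car]
        star_minus)
    have "c * w = w * c"
      using move_past_word[of xs c "\<lambda>x. x"] c(3) F(2) True xs(1) by auto
    have "\<tau> w = \<tau> (c * (c * w))" using c(1) by (simp add: mult.assoc[symmetric])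
    also have "\<dots> = \<tau> (w * c * \<gamma> c)" using tw[of c "c * w"] \<open>c * w = w * c\<close> by simp
    also have "\<dots> = - \<tau> w"
      using \<open>\<gamma> c = - c\<close> c(1) by (simp add: mult.assoc clinear_minus[OF lin])
    finally show ?thesis by (rule complex_eq_minus_self)
  next
    case False
    obtain u where u: "u * u = 1" "\<gamma> u = u" "\<And>l. l \<in> letters a F \<Longrightarrow> u * l = - (\<gamma> l * u)"
      using parity_unitary_for_letters[OF G(1,2) car aut \<gamma>a \<gamma>1 F(1)] by blast
    have uw: "u * w = - (\<gamma> w * u)"
      using move_past_word[of xs u \<gamma>] u(3) F(2) False xs(1) mult \<gamma>1 by auto
    have "\<tau> w = \<tau> (u * (u * w))" using u(1) by (simp add: mult.assoc[symmetric])
    also have "\<dots> = \<tau> ((u * w) * u)" using tw[of u "u * w"] u(2) by simp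
    also have "\<dots> = - \<tau> (\<gamma> w)"
      using u(1) by (simp add: uw mult.assoc clinear_minus[OF lin])
    also have "\<tau> (\<gamma> w) = \<tau> w" using tw[of w 1] by simp
    finally show ?thesis by (rule complex_eq_minus_self)
  qed
qed

text \<open>Remainders produced by anticommuting letters lie in the span of such words.\<close>

definition short_words :: "('h::complex_hilbert \<Rightarrow> 'a::cstar_algebra) \<Rightarrow> nat \<Rightarrow> 'a set"
  where "short_words a n = {prod_list xs |xs. set xs \<subseteq> letters a UNIV \<and> length xs < n}"

lemma letters_anticommute:
  fixes a :: "'h::complex_hilbert \<Rightarrow> 'a::cstar_algebra"
  assumes car: "CAR_algebra a" and "l \<in> letters a UNIV" "m \<in> letters a UNIV"
  obtains s where "l * m = s *\<^sub>C 1 - m * l"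
proof -
  have *: "star (a \<phi>) * star (a \<psi>) = - (star (a \<psi>) * star (a \<phi>))" for \<phi> \<psi>
    using arg_cong[OF CAR_anticommute[OF car, of \<psi> \<phi>], of star] by (simp add: star_mult star_minus)
  have "a \<phi> * star (a \<psi>) = cinner \<phi> \<psi> *\<^sub>C 1 - star (a \<psi>) * a \<phi>" for \<phi> \<psi>
    by (simp add: CAR_star_anticommute[OF car])
  moreover have "a \<phi> * a \<psi> = 0 *\<^sub>C 1 - a \<psi> * a \<phi>" for \<phi> \<psi>
    using CAR_anticommute[OF car, of \<phi> \<psi>] by simp
  moreover have "star (a \<phi>) * star (a \<psi>) = 0 *\<^sub>C 1 - star (a \<psi>) * star (a \<phi>)" for \<phi> \<psi>
    using *[of \<phi> \<psi>] by simp
  ultimately have "\<exists>s. l * m = s *\<^sub>C 1 - m * l"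
    using assms(2,3) CAR_star_anticommute[OF car] unfolding letters_def by blast
  thus ?thesis using that by blast
qed

lemma letter_times_short_word:
  assumes "m \<in> letters a UNIV" "r \<in> cspan (short_words a n)"
  shows "m * r \<in> cspan (short_words a (Suc n))"
proof -
  have "m * w \<in> short_words a (Suc n)" if w: "w \<in> short_words a n" for w
  proof -
    obtain xs where "w = prod_list xs" "set xs \<subseteq> letters a UNIV" "length xs < n"
      using w by (auto simp: short_words_def)
    thus ?thesis using assms(1) unfolding short_words_def
      by (intro CollectI exI[of _ "m # xs"]) auto
  qed
  hence "cspan (short_words a n) \<subseteq> {r. m * r \<in> cspan (short_words a (Suc n))}"
    by (intro complex_vector.span_minimal)
      (auto simp: complex_vector.subspace_def distrib_left mult_scaleC_right
        intro: complex_vector.span_base complex_vector.span_add complex_vector.span_scale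
          complex_vector.span_zero)
  thus ?thesis using assms(2) by auto
qed

text \<open>Each exchange of neighbouring letters changes the sign up to a scalar, and a scalar in place of
  two letters leaves a shorter word.\<close>

lemma letter_past_word:
  fixes a :: "'h::complex_hilbert \<Rightarrow> 'a::cstar_algebra"
  assumes car: "CAR_algebra a" and l: "l \<in> letters a UNIV" and "set xs \<subseteq> letters a UNIV"
  shows "l * prod_list xs - (if even (length xs) then prod_list xs * l else - (prod_list xs * l))
    \<in> cspan (short_words a (length xs))"
  using assms(3)
proof (induction xs)
  case Nil show ?case by (simp add: complex_vector.span_zero)
next
  case (Cons m xs)
  let ?w = "prod_list xs"
  define r where "r = l * ?w - (if even (length xs) then ?w * l else - (?w * l))"
  have m: "m \<in> letters a UNIV" and xs: "set xs \<subseteq> letters a UNIV" using Cons.prems by auto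
  obtain s where s: "l * m = s *\<^sub>C 1 - m * l" using letters_anticommute[OF car l m] .
  have "l * (m * ?w) = s *\<^sub>C ?w - m * (l * ?w)"
    unfolding mult.assoc[symmetric] s
    by (simp add: left_diff_distrib mult_scaleC_left mult.assoc)
  hence eq: "l * prod_list (m # xs) - (if even (length (m # xs)) then prod_list (m # xs) * l
      else - (prod_list (m # xs) * l)) = s *\<^sub>C ?w - m * r"
    by (auto simp: r_def right_diff_distrib distrib_left mult.assoc)
  have "m * r \<in> cspan (short_words a (Suc (length xs)))"
    using Cons.IH[OF xs] by (intro letter_times_short_word[OF m]) (simp add: r_def)
  moreover have "?w \<in> short_words a (Suc (length xs))" using xs by (auto simp: short_words_def)
  ultimately have "s *\<^sub>C ?w - m * r \<in> cspan (short_words a (Suc (length xs)))"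
    by (intro complex_vector.span_diff complex_vector.span_scale)
      (auto intro: complex_vector.span_base)
  thus ?case by (subst eq) (simp only: length_Cons)
qed

text \<open>This is the uniqueness of the trace, stated for the difference of two tracial states.  An odd
  word is killed by a field operator that anticommutes with it.  For an even word \<open>l w\<close>, moving
  \<open>l\<close> to the end gives \<open>l w = - w l\<close> up to shorter words, while the trace property gives
  \<open>\<delta>(l w) = \<delta>(w l)\<close>; so induction on the length reduces everything to \<open>\<delta>(1) = 0\<close>.  The hypothesis
  \<open>room\<close> expresses that the Hilbert space is infinite dimensional.\<close>

lemma trace_zero_on_words:
  fixes a :: "'h::complex_hilbert \<Rightarrow> 'a::cstar_algebra" and \<delta> :: "'a \<Rightarrow> complex"
  assumes car: "CAR_algebra a"
    and room: "\<And>F::'h set. finite F \<Longrightarrow> \<exists>e. cinner e e = 1 \<and> (\<forall>\<phi>\<in>F. cinner e \<phi> = 0)"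
    and lin: "clinear \<delta>" and tr: "\<And>x y. \<delta> (x * y) = \<delta> (y * x)" and one: "\<delta> 1 = 0"
    and "w \<in> words a"
  shows "\<delta> w = 0"
proof -
  have "\<delta> (prod_list xs) = 0" if "set xs \<subseteq> letters a UNIV" for xs
    using that
  proof (induction "length xs" arbitrary: xs rule: less_induct)
    case less
    show ?case
    proof (cases "even (length xs)")
      case False
      obtain F where F: "finite F" "set xs \<subseteq> letters a F"
        using finite_support_of_word[OF less.prems] .
      obtain e where e: "cinner e e = 1" "\<And>\<phi>. \<phi> \<in> F \<Longrightarrow> cinner e \<phi> = 0"
        using room[OF F(1)] by blast
      define c where "c = a e + star (a e)"
      note c = field_unitary[OF car e, of F, folded c_def]
      have cw: "c * prod_list xs = - (prod_list xs * c)"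
        using move_past_word[of xs c "\<lambda>x. x"] c(3) F(2) False by auto
      have "\<delta> (prod_list xs) = \<delta> (c * (c * prod_list xs))"
        using c(1) by (simp add: mult.assoc[symmetric])
      also have "\<dots> = \<delta> (c * prod_list xs * c)" by (rule tr)
      also have "\<dots> = - \<delta> (prod_list xs)"
        using c(1) by (simp add: cw mult.assoc clinear_minus[OF lin])
      finally show ?thesis by (rule complex_eq_minus_self)
    next
      case even: True
      show ?thesis
      proof (cases xs)
        case Nil thus ?thesis using one by simp
      next
        case (Cons l ys)
        let ?w = "prod_list ys"
        have "short_words a (length ys) \<subseteq> {x. \<delta> x = 0}"
          using less.hyps Cons by (auto simp: short_words_def)
        hence "cspan (short_words a (length ys)) \<subseteq> {x. \<delta> x = 0}"
          by (intro complex_vector.span_minimal)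
            (auto simp: complex_vector.subspace_def clinear_zero[OF lin] clinear_add[OF lin]
              clinear_scaleC[OF lin])
        moreover have "l * ?w + ?w * l \<in> cspan (short_words a (length ys))"
          using letter_past_word[OF car, of l ys] less.prems even Cons by simp
        ultimately have "\<delta> (l * ?w + ?w * l) = 0" by blast
        hence "2 * \<delta> (l * ?w) = 0" using tr[of ?w l] by (simp add: clinear_add[OF lin])
        thus ?thesis using Cons by simp
      qed
    qed
  qed
  thus ?thesis using assms(6) by (auto simp: words_def)
qed

section \<open>Extensions of the trace to the crossed product\<close>

lemma positive_functional_if_tracial_state:
  "tracial_state class_cstar \<mu> \<Longrightarrow> positive_functional \<mu>"
  unfolding tracial_state_def class_cstar_def positive_functional_def cstar_data.simps by blast

lemma positive_functional_comp_automorphism: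
  assumes "positive_functional \<mu>" "star_automorphism \<gamma>"
  shows "positive_functional (\<lambda>x. \<mu> (\<gamma> x))"
  using assms unfolding positive_functional_def star_automorphism_def clinear_iff by auto

text \<open>From \<open>G\<^sup>2 = 1\<close>.\<close>

lemma involution_on_words:
  assumes G: "unitary G" "selfadjoint G"
    and aut: "star_automorphism \<gamma>" and \<gamma>a: "\<And>\<phi>. \<gamma> (a \<phi>) = a (G \<phi>)" and "w \<in> words a"
  shows "\<gamma> (\<gamma> w) = w"
proof -
  obtain xs where xs: "w = prod_list xs" "set xs \<subseteq> letters a UNIV"
    using \<open>w \<in> words a\<close> by (auto simp: words_def)
  have "\<gamma> (\<gamma> l) = l" if "l \<in> letters a UNIV" for l
    using that aut unitary_selfadjoint_involution[OF G] \<gamma>a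
    by (auto simp: letters_def star_automorphism_def)
  hence "\<gamma> (\<gamma> (prod_list xs)) = prod_list xs"
    using xs(2) aut by (induction xs) (auto simp: star_automorphism_one star_automorphism_def)
  thus ?thesis using xs by simp
qed

text \<open>Twisting comes from \<open>(x, 0)(0, y) = (0, x y)\<close> and \<open>(0, y)(x, 0) = (0, y \<gamma>(x))\<close>.  Cauchy--Schwarz
  for the pair \<open>(x, 0)\<close>, \<open>(0, y)\<close> yields the bound with \<open>\<mu>(\<gamma>(y\<^sup>*y))\<close> in place of \<open>\<mu>(y\<^sup>*y)\<close>; the two
  coincide because \<open>\<gamma>\<close> is implemented by \<open>(0, 1)\<close> and \<open>T\<close> is a trace.\<close>

lemma crossed_product_extension_gives_twisted_trace:
  fixes \<gamma> :: "'a::cstar_algebra \<Rightarrow> 'a"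
  assumes aut: "star_automorphism \<gamma>"
    and T: "tracial_state (crossed_product_Z2 \<gamma>) T" and ext: "\<And>x. T (x, 0) = \<mu> x"
  shows "twisted_tracial \<gamma> (\<lambda>y. T (0, y))" and "dominated \<mu> (\<lambda>y. T (0, y))"
proof -
  define m where "m = alg_mult (crossed_product_Z2 \<gamma>)"
  define st where "st = alg_star (crossed_product_Z2 \<gamma>)"
  have m: "m (x, y) (x', y') = (x * x' + y * \<gamma> y', x * y' + y * \<gamma> x')" for x y x' y'
    by (simp add: m_def crossed_product_Z2_def)
  have st: "st (x, y) = (star x, \<gamma> (star y))" for x y
    by (simp add: st_def crossed_product_Z2_def)
  have lin: "clinear T" and pos: "\<And>z. T (m (st z) z) \<in> \<real>\<^sub>\<ge>\<^sub>0"
    and tr: "\<And>z z'. T (m z z') = T (m z' z)"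
    using T by (auto simp: tracial_state_def m_def st_def)
  have lin\<gamma>: "clinear \<gamma>" and mult: "\<And>x y. \<gamma> (x * y) = \<gamma> x * \<gamma> y"
    and star\<gamma>: "\<And>x. \<gamma> (star x) = star (\<gamma> x)"
    using aut by (auto simp: star_automorphism_def)
  have \<gamma>0: "\<gamma> 0 = 0" and \<gamma>1: "\<gamma> 1 = 1"
    using clinear_zero[OF lin\<gamma>] star_automorphism_one[OF aut] by auto
  have Tadd: "T (0, x + y) = T (0, x) + T (0, y)" for x y
    using clinear_add[OF lin, of "(0, x)" "(0, y)"] by simp
  have Tscale: "T (0, c *\<^sub>C x) = c *\<^sub>C T (0, x)" for c x
    using clinear_scaleC[OF lin, of c "(0, x)"] by (simp add: scaleC_prod_def)
  show "twisted_tracial \<gamma> (\<lambda>y. T (0, y))"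
    unfolding twisted_tracial_def clinear_iff
    using Tadd Tscale tr[of "(x, 0)" "(0, y)" for x y] by (auto simp: m \<gamma>0)
  have \<mu>\<gamma>: "\<mu> (\<gamma> x) = \<mu> x" for x
    using tr[of "(0, 1)" "(x, 0)"] tr[of "(0, \<gamma> x)" "(0, 1)"] tr[of "(0,1)" "(0,x)"]
    by (simp add: m \<gamma>0 \<gamma>1 ext)
  have CS: "(cmod (T (m (st z) z')))\<^sup>2 \<le> Re (T (m (st z) z)) * Re (T (m (st z') z'))" for z z'
  proof (rule positive_form_Cauchy_Schwarz[of "\<lambda>z z'. T (m (st z) z')"])
    fix x y z :: "'a \<times> 'a" and c :: complex
    have 1: "m (st x) (y + z) = m (st x) y + m (st x) z"
      by (cases x; cases y; cases z) (simp add: m st clinear_add[OF lin\<gamma>] algebra_simps)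
    show "T (m (st x) (y + z)) = T (m (st x) y) + T (m (st x) z)"
      by (simp add: 1 clinear_add[OF lin])
    have 2: "m (st (x + y)) z = m (st x) z + m (st y) z"
      by (cases x; cases y; cases z) (simp add: m st clinear_add[OF lin\<gamma>] star_add algebra_simps)
    show "T (m (st (x + y)) z) = T (m (st x) z) + T (m (st y) z)"
      by (simp add: 2 clinear_add[OF lin])
    have 3: "m (st x) (c *\<^sub>C y) = c *\<^sub>C m (st x) y"
      by (cases x; cases y) (simp add: m st scaleC_prod_def clinear_scaleC[OF lin\<gamma>]
        mult_scaleC_right scaleC_add_right)
    show "T (m (st x) (c *\<^sub>C y)) = c * T (m (st x) y)"
      by (simp add: 3 clinear_scaleC[OF lin] scaleC_complex_def)
    have 4: "m (st (c *\<^sub>C x)) y = cnj c *\<^sub>C m (st x) y"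
      by (cases x; cases y) (simp add: m st scaleC_prod_def clinear_scaleC[OF lin\<gamma>] star_scaleC
        mult_scaleC_left scaleC_add_right)
    show "T (m (st (c *\<^sub>C x)) y) = cnj c * T (m (st x) y)"
      by (simp add: 4 clinear_scaleC[OF lin] scaleC_complex_def)
  qed (rule pos)
  show "dominated \<mu> (\<lambda>y. T (0, y))"
    unfolding dominated_def
  proof (intro allI)
    fix x y
    have "\<mu> (\<gamma> (star y) * \<gamma> y) = \<mu> (star y * y)" using \<mu>\<gamma>[of "star y * y"] mult by simp
    thus "(cmod (T (0, star x * y)))\<^sup>2 \<le> Re (\<mu> (star x * x)) * Re (\<mu> (star y * y))"
      using CS[of "(x, 0)" "(0, y)"] by (simp add: m st \<gamma>0 ext)
  qed
qed

text \<open>The hypothesis \<open>sym\<close> is what the trace property says about the second components.  Formally it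
  follows from \<open>inv\<close> and \<open>\<gamma>\<^sup>2 = 1\<close>.\<close>

lemma canonical_extension_tracial:
  fixes \<gamma> :: "'a::cstar_algebra \<Rightarrow> 'a"
  assumes aut: "star_automorphism \<gamma>" and \<mu>: "tracial_state class_cstar \<mu>"
    and inv: "\<And>x. \<mu> (\<gamma> x) = \<mu> x" and sym: "\<And>x y. \<mu> (x * \<gamma> y) = \<mu> (\<gamma> x * y)"
  shows "tracial_state (crossed_product_Z2 \<gamma>) (\<lambda>(x, y). \<mu> x)"
proof -
  have lin: "clinear \<mu>" and pos: "\<And>x. \<mu> (star x * x) \<in> \<real>\<^sub>\<ge>\<^sub>0" and one: "\<mu> 1 = 1"
    and tr: "\<And>x y. \<mu> (x * y) = \<mu> (y * x)"
    using \<mu> by (auto simp: tracial_state_def class_cstar_def)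
  have "clinear (\<lambda>(x, y::'a). \<mu> x)"
    unfolding clinear_iff
    by (auto simp: scaleC_prod_def clinear_add[OF lin] clinear_scaleC[OF lin])
  moreover have "\<mu> (star x * x + \<gamma> (star y) * \<gamma> y) \<in> \<real>\<^sub>\<ge>\<^sub>0" for x y
  proof -
    have "\<gamma> (star y) * \<gamma> y = \<gamma> (star y * y)" using aut by (simp add: star_automorphism_def)
    thus ?thesis using pos[of x] pos[of y]
      by (simp add: clinear_add[OF lin] inv nonneg_Reals_add_I)
  qed
  moreover have "\<mu> (x * x' + y * \<gamma> y') = \<mu> (x' * x + y' * \<gamma> y)" for x x' y y'
    using tr[of x x'] tr[of y' "\<gamma> y"] sym[of y y'] by (simp add: clinear_add[OF lin])
  ultimately show ?thesis
    unfolding tracial_state_def crossed_product_Z2_def by (auto simp: one)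
qed

theorem proposition3p4:
  fixes G :: "'h::complex_hilbert \<Rightarrow> 'h"
    and a :: "'h \<Rightarrow> 'a::cstar_algebra"
    and \<gamma> :: "'a \<Rightarrow> 'a"
    and \<mu>0 :: "'a \<Rightarrow> complex"
  assumes "unitary G" and "selfadjoint G"
    and "infinite_cdim {x. G x + x = 0}"
    and "CAR_algebra a"
    and "star_automorphism \<gamma>" and "\<And>\<phi>. \<gamma> (a \<phi>) = a (G \<phi>)"
    and "tracial_state class_cstar \<mu>0"
  shows "(\<forall>\<tau>. twisted_tracial \<gamma> \<tau> \<and> dominated \<mu>0 \<tau> \<longleftrightarrow> \<tau> = (\<lambda>x. 0)) \<and>
    (\<forall>T. tracial_state (crossed_product_Z2 \<gamma>) T \<and> (\<forall>x. T (x, 0) = \<mu>0 x)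
      \<longleftrightarrow> T = (\<lambda>(x, y). \<mu>0 x))"
proof -
  note car = assms(4) and aut = assms(5)
  have pos: "positive_functional \<mu>0" using positive_functional_if_tracial_state assms(7) .
  have lin: "clinear \<mu>0" and tr: "\<And>x y. \<mu>0 (x * y) = \<mu>0 (y * x)"
    using assms(7) by (auto simp: tracial_state_def class_cstar_def)
  have lin\<gamma>: "clinear \<gamma>" and mult: "\<And>x y. \<gamma> (x * y) = \<gamma> x * \<gamma> y"
    using aut by (auto simp: star_automorphism_def)
  have vanish: "\<tau> x = 0" if "twisted_tracial \<gamma> \<tau>" "dominated \<mu>0 \<tau>" for \<tau> x
  proof (rule zero_if_zero_on_words[OF car])
    show "clinear \<tau>" using that by (simp add: twisted_tracial_def)
    show "norm_bounded \<tau>" using norm_bounded_if_dominated[OF pos that(2), of 1] by simp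
    show "\<tau> w = 0" if "w \<in> words a" for w
      using twisted_trace_zero_on_words assms(1-6) \<open>twisted_tracial \<gamma> \<tau>\<close> that by blast
  qed
  have zero: "twisted_tracial \<gamma> (\<lambda>x. 0)" "dominated \<mu>0 (\<lambda>x. 0)"
    using pos by (auto simp: twisted_tracial_def clinear_iff dominated_def positive_functional_def
      complex_nonneg_iff)

  have pos\<gamma>: "positive_functional (\<lambda>x. \<mu>0 (\<gamma> x))"
    using positive_functional_comp_automorphism[OF pos aut] .
  have inv: "\<mu>0 (\<gamma> x) = \<mu>0 x" for x
  proof -
    have "\<mu>0 (\<gamma> x) - \<mu>0 x = 0"
    proof (rule zero_if_zero_on_words[OF car, of "\<lambda>x. \<mu>0 (\<gamma> x) - \<mu>0 x"])
      show lin': "clinear (\<lambda>x. \<mu>0 (\<gamma> x) - \<mu>0 x)"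
        using lin lin\<gamma> by (auto simp: clinear_iff scaleC_complex_def algebra_simps)
      show "norm_bounded (\<lambda>x. \<mu>0 (\<gamma> x) - \<mu>0 x)"
        using norm_bounded_diff norm_bounded_if_positive pos pos\<gamma> by blast
      have room: "\<exists>e. cinner e e = 1 \<and> (\<forall>\<phi>\<in>F. cinner e \<phi> = 0)" if "finite F" for F :: "'h set"
        by (rule unit_vector_in_infinite_eigenspace[OF assms(1-3) that]) blast
      show "\<mu>0 (\<gamma> w) - \<mu>0 w = 0" if "w \<in> words a" for w
      proof (rule trace_zero_on_words[OF car room lin' _ _ that])
        show "\<mu>0 (\<gamma> (x * y)) - \<mu>0 (x * y) = \<mu>0 (\<gamma> (y * x)) - \<mu>0 (y * x)" for x y
          using tr[of "\<gamma> x" "\<gamma> y"] tr[of x y] by (simp add: mult)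
      qed (auto simp: star_automorphism_one[OF aut])
    qed
    thus ?thesis by simp
  qed
  have sym: "\<mu>0 (x * \<gamma> y) = \<mu>0 (\<gamma> x * y)" for x y
  proof -
    \<comment> \<open>Writing \<open>x = \<gamma> x'\<close> exhibits \<open>\<mu>0 (x * \<gamma> y)\<close> as a value of the positive functional
        \<open>\<mu>0 \<circ> \<gamma>\<close>, which makes it bounded in \<open>y\<close>.  So it is enough to take a word for \<open>y\<close>, where
        \<open>\<gamma> (\<gamma> y) = y\<close> is known.\<close>
    obtain x' where x': "\<gamma> x' = x" using aut by (metis star_automorphism_def bij_pointE)
    have "\<mu>0 (\<gamma> (x' * y)) - \<mu>0 (\<gamma> x * y) = 0"
    proof (rule zero_if_zero_on_words[OF car, of "\<lambda>y. \<mu>0 (\<gamma> (x' * y)) - \<mu>0 (\<gamma> x * y)"])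
      show "clinear (\<lambda>y. \<mu>0 (\<gamma> (x' * y)) - \<mu>0 (\<gamma> x * y))"
        using lin lin\<gamma> by (auto simp: clinear_iff scaleC_complex_def algebra_simps mult_scaleC_right)
      show "norm_bounded (\<lambda>y. \<mu>0 (\<gamma> (x' * y)) - \<mu>0 (\<gamma> x * y))"
        using norm_bounded_if_dominated[OF pos\<gamma> dominated_by_itself[OF pos\<gamma>]]
          norm_bounded_if_dominated[OF pos dominated_by_itself[OF pos]]
        by (intro norm_bounded_diff) auto
      show "\<mu>0 (\<gamma> (x' * w)) - \<mu>0 (\<gamma> x * w) = 0" if "w \<in> words a" for w
        using inv[of "x * \<gamma> w"] involution_on_words[OF assms(1,2) aut assms(6) that]
        by (simp add: mult x')
    qed
    thus ?thesis by (simp add: mult x')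
  qed
  have unique: "T = (\<lambda>(x, y). \<mu>0 x)"
    if T: "tracial_state (crossed_product_Z2 \<gamma>) T" and ext: "\<And>x. T (x, 0) = \<mu>0 x" for T
  proof
    fix z :: "'a \<times> 'a"
    obtain x y where z: "z = (x, y)" by (cases z)
    have "T (0, y) = 0"
      using vanish crossed_product_extension_gives_twisted_trace[OF aut T ext] by blast
    moreover have "clinear T" using T by (simp add: tracial_state_def)
    ultimately show "T z = (\<lambda>(x, y). \<mu>0 x) z"
      using clinear_add[of T "(x, 0)" "(0, y)"] ext by (simp add: z)
  qed
  have canonical: "tracial_state (crossed_product_Z2 \<gamma>) (\<lambda>(x, y). \<mu>0 x)"
    using canonical_extension_tracial[OF aut assms(7) inv sym] .
  show ?thesis
  proof (intro conjI allI iffI)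
    show "\<tau> = (\<lambda>x. 0)" if "twisted_tracial \<gamma> \<tau> \<and> dominated \<mu>0 \<tau>" for \<tau>
      using vanish that by blast
    show "twisted_tracial \<gamma> \<tau>" "dominated \<mu>0 \<tau>" if "\<tau> = (\<lambda>x. 0)" for \<tau>
      using zero that by simp_all
    show "T = (\<lambda>(x, y). \<mu>0 x)"
      if "tracial_state (crossed_product_Z2 \<gamma>) T \<and> (\<forall>x. T (x, 0) = \<mu>0 x)" for T
      using unique that by blast
    show "tracial_state (crossed_product_Z2 \<gamma>) T" "T (x, 0) = \<mu>0 x"
      if "T = (\<lambda>(x, y). \<mu>0 x)" for T x
      using canonical that by simp_all
  qed
qed

end
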